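(* Let $n\ge 3$ and let $P$ be a tangential hyperbolic $n$-gon with inradius $r(P)$. Then $$\mathrm{Peri}(P)\;\geq\; 2n\,\tanh^{-1}\!\left(\tan(\pi/n)\,\sinh r(P)\right),$$ with equality if and only if $P$ is regular.
   Context: A hyperbolic $n$-gon is a polygon with $n$ geodesic sides in the hyperbolic plane of constant curvature $-1$; all of its vertices are assumed to lie in the hyperbolic plane (no ideal vertices). A polygon is tangential if all its sides are tangent to the same circle (its incircle); $r(P)$ denotes the (hyperbolic) radius of the incircle. $\mathrm{Peri}(P)$ is the sum of the hyperbolic lengths of the sides. A polygon is regular if all its sides are equal and all its interior angles are equal. *)

theory Defs
  imports "HOL-Analysis.Analysis"
begin

text \<open>
  The hyperbolic plane of curvature -1 is taken in the Beltrami-Klein model: its points are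
  the points of the open unit disc \<^term>\<open>ball (0::complex) 1\<close>, and its geodesics are the
  Euclidean chords.  So the geodesic segment between two points is the Euclidean
  \<^const>\<open>closed_segment\<close>.  The model is not conformal: angles are taken with respect to the
  Riemannian metric tensor \<open>klein_metric\<close> and not to the Euclidean one.
\<close>

definition hdist :: "complex \<Rightarrow> complex \<Rightarrow> real" where
  "hdist x y = arcosh ((1 - x \<bullet> y) / sqrt ((1 - (norm x)\<^sup>2) * (1 - (norm y)\<^sup>2)))"

definition hline :: "complex \<Rightarrow> complex \<Rightarrow> complex set" where
  "hline a b = affine hull {a, b} \<inter> ball 0 1"

definition hcircle :: "complex \<Rightarrow> real \<Rightarrow> complex set" where
  "hcircle c r = {x \<in> ball 0 1. hdist c x = r}"

text \<open>The Riemannian inner product at \<open>p\<close> of two tangent vectors; \<^const>\<open>hdist\<close> is its distance.\<close>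

definition klein_metric :: "complex \<Rightarrow> complex \<Rightarrow> complex \<Rightarrow> real" where
  "klein_metric p u w =
     (u \<bullet> w) / (1 - (norm p)\<^sup>2) + (p \<bullet> u) * (p \<bullet> w) / (1 - (norm p)\<^sup>2)\<^sup>2"

text \<open>The angle in \<open>[0, pi]\<close> at \<open>v\<close> between the geodesic rays towards \<open>a\<close> and \<open>b\<close>.\<close>

definition hangle :: "complex \<Rightarrow> complex \<Rightarrow> complex \<Rightarrow> real" where
  "hangle a v b =
     arccos (klein_metric v (a - v) (b - v) /
       sqrt (klein_metric v (a - v) (a - v) * klein_metric v (b - v) (b - v)))"

text \<open>A polygon is given by the list of its vertices in cyclic order; indices are read modulo
  the length.\<close>

definition vertex :: "complex list \<Rightarrow> nat \<Rightarrow> complex" where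
  "vertex P i = P ! (i mod length P)"

definition side :: "complex list \<Rightarrow> nat \<Rightarrow> complex set" where
  "side P i = closed_segment (vertex P i) (vertex P (Suc i))"

definition boundary :: "complex list \<Rightarrow> complex set" where
  "boundary P = (\<Union>i<length P. side P i)"

text \<open>Simple closed polygons: two sides meet only in a common endpoint.  Neither convexity nor
  an orientation is assumed, and straight angles are not excluded.\<close>

definition hyperbolic_polygon :: "nat \<Rightarrow> complex list \<Rightarrow> bool" where
  "hyperbolic_polygon n P \<longleftrightarrow>
     length P = n \<and> set P \<subseteq> ball 0 1 \<and> distinct P \<and>
     (\<forall>i<n. \<forall>j<n. i \<noteq> j \<longrightarrow>
        side P i \<inter> side P j =
          {vertex P i, vertex P (Suc i)} \<inter> {vertex P j, vertex P (Suc j)})"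

definition side_length :: "complex list \<Rightarrow> nat \<Rightarrow> real" where
  "side_length P i = hdist (vertex P i) (vertex P (Suc i))"

definition Peri :: "complex list \<Rightarrow> real" where
  "Peri P = (\<Sum>i<length P. side_length P i)"

text \<open>The interior angle is the angle between the two sides at a vertex \<open>v\<close> or its complement
  to \<open>2 * pi\<close>, according to whether the polygon is convex at \<open>v\<close>, that is, whether the points
  close to \<open>v\<close> in the smaller sector between the sides are inside the polygon.  At a straight
  angle both values are \<open>pi\<close>.\<close>

definition convex_at :: "complex list \<Rightarrow> nat \<Rightarrow> bool" where
  "convex_at P i \<longleftrightarrow>
     (let v = vertex P i; a = vertex P (i + length P - 1); b = vertex P (Suc i)
      in \<forall>\<^sub>F t in at_right (0::real). v + t *\<^sub>R ((a - v) + (b - v)) \<in> inside (boundary P))"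

definition interior_angle :: "complex list \<Rightarrow> nat \<Rightarrow> real" where
  "interior_angle P i =
     (let \<theta> = hangle (vertex P (i + length P - 1)) (vertex P i) (vertex P (Suc i))
      in if convex_at P i then \<theta> else 2 * pi - \<theta>)"

definition regular :: "complex list \<Rightarrow> bool" where
  "regular P \<longleftrightarrow>
     (\<forall>i<length P. \<forall>j<length P. side_length P i = side_length P j) \<and>
     (\<forall>i<length P. \<forall>j<length P. interior_angle P i = interior_angle P j)"

text \<open>The geodesic through \<open>a\<close> and \<open>b\<close> is tangent to the circle, that is, meets it in one
  point, and this point lies on the segment between \<open>a\<close> and \<open>b\<close>, not only on the line.\<close>

definition segment_tangent :: "complex \<Rightarrow> complex \<Rightarrow> complex \<Rightarrow> real \<Rightarrow> bool" where
  "segment_tangent a b c r \<longleftrightarrow> (\<exists>p\<in>closed_segment a b. hline a b \<inter> hcircle c r = {p})"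

definition incircle :: "complex list \<Rightarrow> complex \<Rightarrow> real \<Rightarrow> bool" where
  "incircle P c r \<longleftrightarrow>
     c \<in> ball 0 1 \<and> r > 0 \<and>
     (\<forall>i<length P. segment_tangent (vertex P i) (vertex P (Suc i)) c r)"

end

theory Submission
  imports Defs
begin

text \<open>
  In the Klein model a hyperbolic translation is a projective map of the disc, so the incentre can
  be moved to \<open>0\<close>, where the incircle is the Euclidean circle of radius \<open>tanh r\<close>.  If
  \<open>\<theta> i\<close> is the angle at the centre between the \<open>i\<close>-th vertex and either neighbouring
  tangency point, the tangent segments at this vertex have hyperbolic length
  \<open>artanh (sinh r * tan (\<theta> i))\<close>, which is a strictly convex function of the angle.  The sum
  of the \<open>\<theta> i\<close> is a positive multiple of \<open>pi\<close>, so Jensen's inequality gives the bound, with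
  equality only if every \<open>\<theta> i\<close> is \<open>pi / n\<close>.  Conversely the interior angle determines
  \<open>\<theta> i\<close>, so in a regular polygon all \<open>\<theta> i\<close> agree, and simplicity excludes a sum larger
  than \<open>pi\<close>.
\<close>

section \<open>Hyperbolic translations in the Klein model\<close>

text \<open>Neither an orientation nor convexity nor a winding number comes with the polygon. The
  central half-angles therefore carry a sign at first, and simplicity is what forces one common
  sign; straight angles, where the half-angle is zero, are the delicate case. Closing up then yields
  only a total of \<open>k * pi\<close> with \<open>k \<noteq> 0\<close>. This is enough for the
  bound, because the tangent line used in Jensen's inequality has positive slope, so a larger total
  only helps. The same total shows \<open>sinh r * tan (pi / n) < 1\<close>, without which the bound
  would lie outside the domain of \<open>artanh\<close>.

  The rest of the work comes from \<open>interior_angle\<close>, whose case distinction refers to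
  \<open>inside (boundary P)\<close> and to a Euclidean direction at the vertex. A regular polygon
  is handled through \<open>hangle \<le> pi\<close>: an angle and a complement to
  \<open>2 * pi\<close> can agree only at \<open>pi\<close>. In the equality case all tangency
  points are known explicitly, and convexity is verified with the half-planes that they
  define.\<close>

text \<open>In homogeneous coordinates this is the Lorentz boost that takes \<open>c\<close> to \<open>0\<close>; the term
  \<open>(c \<bullet> x) / (1 + sqrt (1 - (norm c)\<^sup>2))\<close> avoids dividing by the norm of \<open>c\<close>.\<close>

definition htrans :: "complex \<Rightarrow> complex \<Rightarrow> complex" where
  "htrans c x =
     (sqrt (1 - (norm c)\<^sup>2) *\<^sub>R x + ((c \<bullet> x) / (1 + sqrt (1 - (norm c)\<^sup>2))) *\<^sub>R c - c) /\<^sub>R (1 - c \<bullet> x)"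

lemma inner_less_1:
  fixes x y :: complex
  assumes "x \<in> ball 0 1" "y \<in> ball 0 1"
  shows "x \<bullet> y < 1"
proof -
  have "x \<bullet> y \<le> norm x * norm y" by (rule norm_cauchy_schwarz)
  also have "\<dots> < 1" using assms mult_strict_mono[of "norm x" 1 "norm y" 1] by simp
  finally show ?thesis .
qed

lemma norm_sq_less_1: "(x::complex) \<in> ball 0 1 \<Longrightarrow> (norm x)\<^sup>2 < 1"
  by (simp add: power_less_one_iff abs_square_less_1)

text \<open>In homogeneous coordinates \<open>1 - x \<bullet> y\<close> is, up to sign, the Lorentz
  product of \<open>(1, x)\<close> and \<open>(1, y)\<close>. The boost preserves this product, and
  the factors come from rescaling the images to first coordinate 1. Distances and angles are both
  expressed by this form, so their invariance follows from it.\<close>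

lemma htrans_form:
  assumes c: "c \<in> ball 0 1" and x: "x \<in> ball 0 1" and y: "y \<in> ball 0 1"
  shows "1 - htrans c x \<bullet> htrans c y =
    (1 - (norm c)\<^sup>2) * (1 - x \<bullet> y) / ((1 - c \<bullet> x) * (1 - c \<bullet> y))"
proof -
  define s where "s = sqrt (1 - (norm c)\<^sup>2)"
  have s2: "s\<^sup>2 = 1 - c \<bullet> c" and s0: "s > 0"
    using norm_sq_less_1[OF c] by (auto simp: s_def dot_square_norm)
  have ne: "1 - c \<bullet> x \<noteq> 0" "1 - c \<bullet> y \<noteq> 0" using inner_less_1 c x y by force+
  define X where "X = s *\<^sub>R x + ((c \<bullet> x) / (1 + s)) *\<^sub>R c - c"
  define Y where "Y = s *\<^sub>R y + ((c \<bullet> y) / (1 + s)) *\<^sub>R c - c"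
  have cc: "c \<bullet> c = (1 - s) * (1 + s)" using s2 by (simp add: algebra_simps power2_eq_square)
  have s1: "1 + s \<noteq> 0" using s0 by simp
  define a where "a = (c \<bullet> x) / (1 + s)"
  define b where "b = (c \<bullet> y) / (1 + s)"
  have ax: "c \<bullet> x = a * (1 + s)" and bx: "c \<bullet> y = b * (1 + s)" using s1 by (auto simp: a_def b_def)
  have "X \<bullet> Y = s\<^sup>2 * (x \<bullet> y) + s * b * (c \<bullet> x) - s * (c \<bullet> x) + a * s * (c \<bullet> y) + a * b * (c \<bullet> c)
      - a * (c \<bullet> c) - s * (c \<bullet> y) - b * (c \<bullet> c) + c \<bullet> c"
    unfolding X_def Y_def a_def[symmetric] b_def[symmetric]
    by (simp add: inner_add_left inner_add_right inner_diff_left inner_diff_right power2_eq_square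
       inner_commute algebra_simps)
  then have XY: "(1 - c \<bullet> x) * (1 - c \<bullet> y) - X \<bullet> Y = s\<^sup>2 * (1 - x \<bullet> y)"
    unfolding ax bx cc by algebra
  have "htrans c x \<bullet> htrans c y = (X \<bullet> Y) / ((1 - c \<bullet> x) * (1 - c \<bullet> y))"
    by (simp add: htrans_def X_def Y_def s_def divide_simps)
  moreover have "1 - (X \<bullet> Y) / D = (D - X \<bullet> Y) / D" if "D \<noteq> 0" for D
    using that by (simp add: field_simps)
  ultimately show ?thesis using XY ne s2 by (simp add: dot_square_norm)
qed

lemma htrans_in_ball:
  assumes c: "c \<in> ball 0 1" and x: "x \<in> ball 0 1"
  shows "htrans c x \<in> ball 0 1"
proof -
  have "0 < (1 - (norm c)\<^sup>2) * (1 - x \<bullet> x) / ((1 - c \<bullet> x) * (1 - c \<bullet> x))"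
    using norm_sq_less_1[OF c] inner_less_1[OF x x] inner_less_1[OF c x] by simp
  then have "htrans c x \<bullet> htrans c x < 1" using htrans_form[OF c x x] by simp
  then show ?thesis by (simp add: dot_square_norm abs_square_less_1)
qed

lemma htrans_self: "c \<in> ball 0 1 \<Longrightarrow> htrans c c = 0"
proof -
  assume c: "c \<in> ball 0 1"
  define s where "s = sqrt (1 - (norm c)\<^sup>2)"
  have s2: "s\<^sup>2 = 1 - c \<bullet> c" and s0: "s > 0"
    using norm_sq_less_1[OF c] by (auto simp: s_def dot_square_norm)
  have "c \<bullet> c = (1 - s) * (1 + s)" using s2 by (simp add: algebra_simps power2_eq_square)
  then have "(c \<bullet> c) / (1 + s) = 1 - s" using s0 by simp
  moreover have "s *\<^sub>R c + (1 - s) *\<^sub>R c - c = 0" by (simp add: algebra_simps)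
  ultimately show ?thesis unfolding htrans_def s_def[symmetric] by simp
qed

text \<open>The inverse of a boost is the boost with opposite velocity, and \<open>s\<close> is the
  same for both. The cancellation behind it is \<open>l + c \<bullet> X = s\<^sup>2\<close>.\<close>

lemma htrans_inverse:
  assumes c: "c \<in> ball 0 1" and x: "x \<in> ball 0 1"
  shows "htrans (- c) (htrans c x) = x"
proof -
  define s where "s = sqrt (1 - (norm c)\<^sup>2)"
  have s2: "s\<^sup>2 = 1 - c \<bullet> c" and s0: "s > 0"
    using norm_sq_less_1[OF c] by (auto simp: s_def dot_square_norm)
  have cc: "c \<bullet> c = (1 - s) * (1 + s)" using s2 by (simp add: algebra_simps power2_eq_square)
  define a where "a = (c \<bullet> x) / (1 + s)"
  define l where "l = 1 - c \<bullet> x"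
  define X where "X = s *\<^sub>R x + a *\<^sub>R c - c"
  have l: "l > 0" using inner_less_1[OF c x] by (simp add: l_def)
  have ax: "c \<bullet> x = a * (1 + s)" using s0 by (auto simp: a_def)
  have F: "htrans c x = X /\<^sub>R l" by (simp add: htrans_def X_def a_def s_def l_def)
  have "c \<bullet> X = s * (c \<bullet> x) + a * (c \<bullet> c) - c \<bullet> c"
    by (simp add: X_def inner_add_right inner_diff_right)
  then have cX: "c \<bullet> X = (1 + s) * (a - (1 - s))" unfolding ax cc by algebra
  have l': "l = 1 - a * (1 + s)" using ax l_def by simp
  have lX: "l + c \<bullet> X = s\<^sup>2" unfolding cX l' by algebra
  have "1 - (- c) \<bullet> htrans c x = (l + c \<bullet> X) / l"
    using l by (simp add: F field_simps)
  then have D: "1 - (- c) \<bullet> htrans c x = s\<^sup>2 / l" using lX by simp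
  have q: "((- c) \<bullet> htrans c x) / (1 + s) = - (a - (1 - s)) / l"
    using s0 cX by (simp add: F inner_scaleR_right) (simp add: divide_simps)
  have "s *\<^sub>R htrans c x + (((- c) \<bullet> htrans c x) / (1 + s)) *\<^sub>R (- c) - (- c)
     = (s *\<^sub>R X + (a - (1 - s)) *\<^sub>R c + l *\<^sub>R c) /\<^sub>R l"
    unfolding q unfolding F using l
    by (simp add: field_simps) (simp add: scaleR_left_distrib[symmetric] add_divide_distrib[symmetric])
  also have "s *\<^sub>R X + (a - (1 - s)) *\<^sub>R c + l *\<^sub>R c = s\<^sup>2 *\<^sub>R x + (s * a - s + a - 1 + s + l) *\<^sub>R c"
    by (simp add: X_def algebra_simps power2_eq_square)
  also have "s * a - s + a - 1 + s + l = 0" unfolding l' by algebra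
  finally have "htrans (- c) (htrans c x) = (s\<^sup>2 *\<^sub>R x /\<^sub>R l) /\<^sub>R (s\<^sup>2 / l)"
    unfolding htrans_def[of "- c"] D by (simp add: s_def)
  then show ?thesis using s0 l by simp
qed

lemma htrans_inverse':
  assumes c: "c \<in> ball 0 1" and x: "x \<in> ball 0 1"
  shows "htrans c (htrans (- c) x) = x"
  using htrans_inverse[of "- c" x] assms by simp

text \<open>Numerator and denominator of \<open>htrans c\<close> are both affine in the point.
  Dividing by the denominator reweights the coefficients, which produces \<open>u\<close>: a
  projective map keeps lines but not ratios.\<close>

lemma htrans_affine:
  assumes c: "c \<in> ball 0 1"
    and x: "x \<in> ball 0 1" and y: "y \<in> ball 0 1" and z: "(1 - t) *\<^sub>R x + t *\<^sub>R y \<in> ball 0 1"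
    and u: "u = t * (1 - c \<bullet> y) / (1 - c \<bullet> ((1 - t) *\<^sub>R x + t *\<^sub>R y))"
  shows "htrans c ((1 - t) *\<^sub>R x + t *\<^sub>R y) = (1 - u) *\<^sub>R htrans c x + u *\<^sub>R htrans c y"
proof -
  define s where "s = sqrt (1 - (norm c)\<^sup>2)"
  define N where "N = (\<lambda>x. s *\<^sub>R x + ((c \<bullet> x) / (1 + s)) *\<^sub>R c - c)"
  define l where "l = (\<lambda>x. 1 - c \<bullet> x)"
  let ?z = "(1 - t) *\<^sub>R x + t *\<^sub>R y"
  have pos: "l x > 0" "l y > 0" "l ?z > 0" using inner_less_1 c x y z by (auto simp: l_def)
  have F: "htrans c v = N v /\<^sub>R l v" for v by (simp add: htrans_def N_def l_def s_def)
  have lz: "l ?z = (1 - t) * l x + t * l y"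
    by (simp add: l_def inner_add_right algebra_simps)
  have Nz: "N ?z = (1 - t) *\<^sub>R N x + t *\<^sub>R N y"
    by (simp add: N_def inner_add_right algebra_simps add_divide_distrib diff_divide_distrib)
  have u: "u = t * l y / l ?z" by (simp add: u l_def)
  have "1 - u = (l ?z - t * l y) / l ?z" unfolding u using pos(3) by (simp add: field_simps)
  then have u1: "1 - u = (1 - t) * l x / l ?z" unfolding lz by simp
  have "(1 - u) *\<^sub>R htrans c x + u *\<^sub>R htrans c y = ((1 - t) *\<^sub>R N x + t *\<^sub>R N y) /\<^sub>R l ?z"
    unfolding u1 unfolding u F using pos(1,2) by (simp add: scaleR_add_right divide_simps)
  then show ?thesis by (simp add: F Nz)
qed

lemma hdist_htrans:
  assumes c: "c \<in> ball 0 1" and x: "x \<in> ball 0 1" and y: "y \<in> ball 0 1"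
  shows "hdist (htrans c x) (htrans c y) = hdist x y"
proof -
  define S where "S = 1 - (norm c)\<^sup>2"
  define a where "a = 1 - c \<bullet> x"
  define b where "b = 1 - c \<bullet> y"
  have pos: "S > 0" "a > 0" "b > 0"
    using norm_sq_less_1[OF c] inner_less_1[OF c] x y by (auto simp: S_def a_def b_def)
  have "(1 - (norm (htrans c x))\<^sup>2) * (1 - (norm (htrans c y))\<^sup>2)
     = (S / (a * b))\<^sup>2 * ((1 - (norm x)\<^sup>2) * (1 - (norm y)\<^sup>2))"
    using htrans_form[OF c x x] htrans_form[OF c y y]
    unfolding dot_square_norm S_def[symmetric] a_def[symmetric] b_def[symmetric]
    by (simp add: power2_eq_square mult_ac)
  then have "sqrt ((1 - (norm (htrans c x))\<^sup>2) * (1 - (norm (htrans c y))\<^sup>2))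
     = (S / (a * b)) * sqrt ((1 - (norm x)\<^sup>2) * (1 - (norm y)\<^sup>2))"
    using pos by (simp add: real_sqrt_mult)
  then show ?thesis unfolding hdist_def using htrans_form[OF c x y] pos
    by (simp add: S_def[symmetric] a_def[symmetric] b_def[symmetric])
qed

text \<open>Once the metric is written through the Lorentz form alone, \<open>htrans_form\<close>
  gives its behaviour under translations without differentiating \<open>htrans\<close>.\<close>

lemma klein_metric_diff:
  assumes v: "v \<in> ball 0 1"
  shows "klein_metric v (a - v) (b - v) =
    ((1 - v \<bullet> a) * (1 - v \<bullet> b) - (1 - a \<bullet> b) * (1 - v \<bullet> v)) / (1 - v \<bullet> v)\<^sup>2"
proof -
  define B where "B = 1 - v \<bullet> v"
  have B: "B > 0" using inner_less_1[OF v v] by (simp add: B_def)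
  have "klein_metric v (a - v) (b - v) =
     ((a - v) \<bullet> (b - v) * B + (v \<bullet> (a - v)) * (v \<bullet> (b - v))) / B\<^sup>2"
    using B unfolding klein_metric_def dot_square_norm[symmetric] B_def[symmetric]
    by (simp add: add_divide_distrib power2_eq_square)
  also have "(a - v) \<bullet> (b - v) * B + (v \<bullet> (a - v)) * (v \<bullet> (b - v))
     = (1 - v \<bullet> a) * (1 - v \<bullet> b) - (1 - a \<bullet> b) * B"
    by (simp add: B_def inner_diff_left inner_diff_right inner_commute algebra_simps)
  finally show ?thesis by (simp add: B_def)
qed

lemma hangle_htrans:
  assumes c: "c \<in> ball 0 1" and x: "x \<in> ball 0 1" and v: "v \<in> ball 0 1" and y: "y \<in> ball 0 1"
  shows "hangle (htrans c x) (htrans c v) (htrans c y) = hangle x v y"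
proof -
  define S where "S = 1 - (norm c)\<^sup>2"
  define l where "l = (\<lambda>x. 1 - c \<bullet> x)"
  have S: "S > 0" using norm_sq_less_1[OF c] by (simp add: S_def)
  have l: "l z > 0" if "z \<in> ball 0 1" for z using inner_less_1[OF c that] by (simp add: l_def)
  have form: "1 - htrans c a \<bullet> htrans c b = S * (1 - a \<bullet> b) / (l a * l b)"
    if "a \<in> ball 0 1" "b \<in> ball 0 1" for a b
    using htrans_form[OF c that] by (simp add: S_def l_def)
  \<comment> \<open>The differential of the map sends the chord vector \<open>a - v\<close> to a
    positive multiple of the image chord. This is the source of the factor, which cancels in the
    quotient that defines the angle.\<close>
  have km: "klein_metric (htrans c v) (htrans c a - htrans c v) (htrans c b - htrans c v)
      = (l v * l v) / (l a * l b) * klein_metric v (a - v) (b - v)"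
    if a: "a \<in> ball 0 1" and b: "b \<in> ball 0 1" for a b
  proof -
    have alg: "((S * A / (m * p)) * (S * B / (m * k)) - (S * C / (p * k)) * (S * D / (m * m))) / (S * D / (m * m))\<^sup>2
        = (m * m) / (p * k) * ((A * B - C * D) / D\<^sup>2)"
      if "m > 0" "p > 0" "k > 0" "D > 0" for A B C D m p k :: real
    proof -
      have "(S * A / (m * p)) * (S * B / (m * k)) - (S * C / (p * k)) * (S * D / (m * m))
          = S\<^sup>2 * (A * B - C * D) / (m * m * (p * k))"
        using that by (simp add: power2_eq_square field_simps)
      then show ?thesis using that S by (simp add: power2_eq_square mult_ac)
    qed
    have "1 - v \<bullet> v > 0" using inner_less_1[OF v v] by simp
    then show ?thesis
      unfolding klein_metric_diff[OF htrans_in_ball[OF c v]] klein_metric_diff[OF v] form[OF v a] form[OF v b]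
        form[OF a b] form[OF v v] by (rule alg[OF l[OF v] l[OF a] l[OF b]])
  qed
  let ?f = "(l v * l v) / (l x * l y)"
  have f: "?f > 0" using l x y v by simp
  have "klein_metric (htrans c v) (htrans c x - htrans c v) (htrans c x - htrans c v) *
        klein_metric (htrans c v) (htrans c y - htrans c v) (htrans c y - htrans c v)
      = ?f\<^sup>2 * (klein_metric v (x - v) (x - v) * klein_metric v (y - v) (y - v))"
    unfolding km[OF x x] km[OF y y] by (simp add: power2_eq_square mult_ac)
  then have "sqrt (klein_metric (htrans c v) (htrans c x - htrans c v) (htrans c x - htrans c v) *
        klein_metric (htrans c v) (htrans c y - htrans c v) (htrans c y - htrans c v))
      = ?f * sqrt (klein_metric v (x - v) (x - v) * klein_metric v (y - v) (y - v))"
    using f by (simp only: real_sqrt_mult[of "?f\<^sup>2"] real_sqrt_abs abs_of_pos)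
  then show ?thesis unfolding hangle_def km[OF x y] using f
    by (metis (no_types, lifting) less_irrefl mult_divide_mult_cancel_left)
qed

section \<open>Segments, geodesics and tangency under translations\<close>

lemma closed_segment_in_ball:
  "a \<in> ball 0 1 \<Longrightarrow> b \<in> ball 0 1 \<Longrightarrow> closed_segment a b \<subseteq> ball (0::complex) 1"
  by (simp add: closed_segment_subset)

lemma htrans_closed_segment_subset:
  assumes c: "c \<in> ball 0 1" and x: "x \<in> ball 0 1" and y: "y \<in> ball 0 1"
  shows "htrans c ` closed_segment x y \<subseteq> closed_segment (htrans c x) (htrans c y)"
proof
  fix w assume "w \<in> htrans c ` closed_segment x y"
  then obtain t where t: "0 \<le> t" "t \<le> 1" and w: "w = htrans c ((1 - t) *\<^sub>R x + t *\<^sub>R y)"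
    by (auto simp: closed_segment_def)
  let ?z = "(1 - t) *\<^sub>R x + t *\<^sub>R y"
  have z: "?z \<in> ball 0 1" using closed_segment_in_ball[OF x y] t by (force simp: closed_segment_def)
  define u where "u = t * (1 - c \<bullet> y) / (1 - c \<bullet> ?z)"
  have pos: "1 - c \<bullet> x > 0" "1 - c \<bullet> y > 0" "1 - c \<bullet> ?z > 0" using inner_less_1 c x y z by auto
  have "1 - c \<bullet> ?z = (1 - t) * (1 - c \<bullet> x) + t * (1 - c \<bullet> y)"
    by (simp add: inner_add_right algebra_simps)
  moreover have "0 \<le> (1 - t) * (1 - c \<bullet> x)" using t pos by simp
  ultimately have "t * (1 - c \<bullet> y) \<le> 1 - c \<bullet> ?z" by linarith
  then have "u \<le> 1" "0 \<le> u" using pos t by (auto simp: u_def)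
  then show "w \<in> closed_segment (htrans c x) (htrans c y)"
    using htrans_affine[OF c x y z u_def] w by (auto simp: closed_segment_def)
qed

lemma htrans_closed_segment:
  assumes c: "c \<in> ball 0 1" and x: "x \<in> ball 0 1" and y: "y \<in> ball 0 1"
  shows "htrans c ` closed_segment x y = closed_segment (htrans c x) (htrans c y)"
proof
  show "closed_segment (htrans c x) (htrans c y) \<subseteq> htrans c ` closed_segment x y"
  proof
    fix w assume w: "w \<in> closed_segment (htrans c x) (htrans c y)"
    have wb: "w \<in> ball 0 1" using w closed_segment_in_ball htrans_in_ball[OF c] x y by blast
    have "htrans (- c) w \<in> closed_segment x y"
      using htrans_closed_segment_subset[of "- c" "htrans c x" "htrans c y"] w c
        htrans_in_ball[OF c] x y htrans_inverse[OF c] by auto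
    then show "w \<in> htrans c ` closed_segment x y"
      using htrans_inverse'[OF c wb] by (metis imageI)
  qed
qed (rule htrans_closed_segment_subset[OF assms])

lemma htrans_hline:
  assumes c: "c \<in> ball 0 1" and x: "x \<in> ball 0 1" and y: "y \<in> ball 0 1" and w: "w \<in> hline x y"
  shows "htrans c w \<in> hline (htrans c x) (htrans c y)"
proof -
  obtain t' t where "w = t' *\<^sub>R x + t *\<^sub>R y" "t' + t = 1" and wb: "w \<in> ball 0 1"
    using w by (auto simp: hline_def affine_hull_2)
  then have wt: "w = (1 - t) *\<^sub>R x + t *\<^sub>R y" by (simp add: eq_diff_eq[symmetric])
  define u where "u = t * (1 - c \<bullet> y) / (1 - c \<bullet> w)"
  have "htrans c w = (1 - u) *\<^sub>R htrans c x + u *\<^sub>R htrans c y"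
    using htrans_affine[OF c x y, of t u] wb by (simp add: wt u_def)
  then show ?thesis using htrans_in_ball[OF c wb] unfolding hline_def affine_hull_2
    by (metis (mono_tags, lifting) IntI diff_add_cancel mem_Collect_eq)
qed

lemma segment_tangent_htrans:
  assumes c: "c \<in> ball 0 1" and a: "a \<in> ball 0 1" and b: "b \<in> ball 0 1"
    and tan: "segment_tangent a b c r"
  shows "segment_tangent (htrans c a) (htrans c b) 0 r"
proof -
  obtain p where p: "p \<in> closed_segment a b" and I: "hline a b \<inter> hcircle c r = {p}"
    using tan by (auto simp: segment_tangent_def)
  have pb: "p \<in> ball 0 1" using p closed_segment_in_ball[OF a b] by blast
  have dp: "hdist c p = r" using I by (auto simp: hcircle_def)
  have "htrans c p \<in> hline (htrans c a) (htrans c b) \<inter> hcircle 0 r"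
    using htrans_hline[OF c a b, of p] I hdist_htrans[OF c c pb] htrans_self[OF c] dp htrans_in_ball[OF c pb]
    by (auto simp: hcircle_def)
  moreover have "y = htrans c p" if y: "y \<in> hline (htrans c a) (htrans c b) \<inter> hcircle 0 r" for y
  proof -
    have yb: "y \<in> ball 0 1" and dy: "hdist 0 y = r" using y by (auto simp: hcircle_def)
    have c': "- c \<in> ball 0 1" using c by simp
    let ?z = "htrans (- c) y"
    have zb: "?z \<in> ball 0 1" using htrans_in_ball[OF c' yb] .
    have "?z \<in> hline a b"
      using htrans_hline[OF c' htrans_in_ball[OF c a] htrans_in_ball[OF c b], of y] y
        htrans_inverse[OF c a] htrans_inverse[OF c b] by simp
    moreover have "hdist c ?z = r"
      using hdist_htrans[OF c c zb] htrans_self[OF c] htrans_inverse'[OF c yb] dy by simp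
    ultimately have "?z = p" using I zb by (auto simp: hcircle_def)
    then show ?thesis using htrans_inverse'[OF c yb] by simp
  qed
  ultimately have "hline (htrans c a) (htrans c b) \<inter> hcircle 0 r = {htrans c p}" by blast
  then show ?thesis using p htrans_closed_segment[OF c a b] unfolding segment_tangent_def by blast
qed

section \<open>Convexity of the length of a tangent segment\<close>

lemma artanh_tan_deriv:
  fixes S x :: real
  assumes S: "S > 0" and x: "0 \<le> x" "x < pi / 2" and Sx: "S * tan x < 1"
  shows "((\<lambda>x. artanh (S * tan x)) has_real_derivative S / ((cos x)\<^sup>2 * (1 - (S * tan x)\<^sup>2))) (at x)"
proof -
  have c: "cos x > 0" using x by (intro cos_gt_zero_pi) auto
  have "0 \<le> tan x" using x by (simp add: tan_pos_pi2_le)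
  then have a: "\<bar>S * tan x\<bar> < 1" using Sx S by (simp add: abs_mult)
  have "((\<lambda>x. artanh (S * tan x)) has_real_derivative 1 / (1 - (S * tan x)\<^sup>2) * (S * inverse ((cos x)\<^sup>2))) (at x)"
    using a c by (intro DERIV_chain2[OF artanh_real_has_field_derivative] DERIV_cmult DERIV_tan) auto
  then show ?thesis using c by (simp add: field_simps)
qed

text \<open>The derivative of \<open>artanh (S * tan x)\<close> is strictly increasing, so the graph lies above its
  tangent line.\<close>

lemma artanh_tan_above_tangent:
  fixes S x y :: real
  assumes S: "S > 0" and x: "0 \<le> x" "x < pi / 2" "S * tan x < 1"
    and y: "0 \<le> y" "y < pi / 2" "S * tan y < 1" and ne: "x \<noteq> y"
  shows "artanh (S * tan x) >
    artanh (S * tan y) + S / ((cos y)\<^sup>2 * (1 - (S * tan y)\<^sup>2)) * (x - y)"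
proof -
  define f' where "f' = (\<lambda>x. S / ((cos x)\<^sup>2 * (1 - (S * tan x)\<^sup>2)))"
  have cpos: "cos z > 0" if "0 \<le> z" "z < pi / 2" for z using that by (intro cos_gt_zero_pi) auto
  \<comment> \<open>The denominator is a product of two positive factors that both decrease in the
    angle, the first one strictly.\<close>
  have mono: "f' u < f' v" if uv: "0 \<le> u" "u < v" "v < pi / 2" "S * tan v < 1" for u v
  proof -
    have c: "cos v > 0" "cos v < cos u" using uv cpos cos_monotone_0_pi[of u v] by auto
    have t: "0 \<le> tan u" "tan u < tan v" using uv by (auto intro!: tan_monotone simp: tan_pos_pi2_le)
    have 1: "(cos v)\<^sup>2 < (cos u)\<^sup>2" using c by (intro power_strict_mono) auto
    have 2: "(S * tan u)\<^sup>2 \<le> (S * tan v)\<^sup>2" using S t by (intro power_mono mult_left_mono) auto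
    have 3: "(S * tan v)\<^sup>2 < 1" using uv(4) S t by (simp add: abs_square_less_1)
    have "(cos v)\<^sup>2 * (1 - (S * tan v)\<^sup>2) < (cos u)\<^sup>2 * (1 - (S * tan u)\<^sup>2)"
      using 1 2 3 c by (intro mult_less_le_imp_less) auto
    then show ?thesis unfolding f'_def using S 2 3 c by (intro divide_strict_left_mono mult_pos_pos) auto
  qed
  have tan_less: "S * tan z < 1" if "0 \<le> z" "z \<le> max x y" for z
  proof -
    have "tan z \<le> tan (max x y)" using that x y by (intro tan_mono_le) auto
    then have "S * tan z \<le> S * tan (max x y)" using S by simp
    then show ?thesis using x y by (auto simp: max_def split: if_splits)
  qed
  have der: "((\<lambda>x. artanh (S * tan x)) has_real_derivative f' z) (at z)" if "0 \<le> z" "z \<le> max x y" for z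
    unfolding f'_def using that x y tan_less[OF that] S by (intro artanh_tan_deriv) auto
  have "artanh (S * tan y) + f' y * (x - y) < artanh (S * tan x)"
  proof (cases "x < y")
    case True
    then obtain z where z: "x < z" "z < y" "artanh (S * tan y) - artanh (S * tan x) = (y - x) * f' z"
      using MVT2[of x y "\<lambda>x. artanh (S * tan x)" f'] der x by force
    have "f' z < f' y" using mono[of z y] z x y by auto
    then have "(y - x) * f' z < (y - x) * f' y" using True by simp
    then show "artanh (S * tan y) + f' y * (x - y) < artanh (S * tan x)" using z(3) by (simp add: algebra_simps)
  next
    case False
    then have yx: "y < x" using ne by simp
    then obtain z where z: "y < z" "z < x" "artanh (S * tan x) - artanh (S * tan y) = (x - y) * f' z"
      using MVT2[of y x "\<lambda>x. artanh (S * tan x)" f'] der y by force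
    have "f' y < f' z" using mono[of y z] z x y tan_less[of z] by auto
    then have "(x - y) * f' y < (x - y) * f' z" using yx by simp
    then show "artanh (S * tan y) + f' y * (x - y) < artanh (S * tan x)" using z(3) by (simp add: algebra_simps)
  qed
  then show ?thesis by (simp add: f'_def)
qed

text \<open>Jensen's inequality by summing the gaps \<open>g\<close> between the graph and its
  tangent line at \<open>y\<close>; in the equality case every gap has to vanish. The slope
  \<open>k\<close> is positive, so a lower bound on the sum of the angles suffices.\<close>

lemma sum_artanh_tan_ge:
  fixes S y :: real and \<theta> :: "nat \<Rightarrow> real"
  assumes S: "S > 0" and \<theta>: "\<And>i. i < n \<Longrightarrow> 0 \<le> \<theta> i \<and> \<theta> i < pi / 2 \<and> S * tan (\<theta> i) < 1"
    and y: "0 \<le> y" "y < pi / 2" "S * tan y < 1" and sum: "(\<Sum>i<n. \<theta> i) \<ge> real n * y"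
  shows "(\<Sum>i<n. artanh (S * tan (\<theta> i))) \<ge> real n * artanh (S * tan y)"
    and "(\<Sum>i<n. artanh (S * tan (\<theta> i))) = real n * artanh (S * tan y) \<Longrightarrow> i < n \<Longrightarrow> \<theta> i = y"
proof -
  define k where "k = S / ((cos y)\<^sup>2 * (1 - (S * tan y)\<^sup>2))"
  have "0 \<le> tan y" using y by (auto simp: tan_pos_pi2_le)
  then have "(S * tan y)\<^sup>2 < 1" using y S by (simp add: abs_square_less_1)
  moreover have "cos y > 0" using y by (intro cos_gt_zero_pi) auto
  ultimately have k: "k > 0" using S by (simp add: k_def)
  define g where "g = (\<lambda>x. artanh (S * tan x) - (artanh (S * tan y) + k * (x - y)))"
  have gpos: "g (\<theta> i) > 0" if "i < n" "\<theta> i \<noteq> y" for i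
    using artanh_tan_above_tangent[OF S _ _ _ y, of "\<theta> i"] \<theta>[OF that(1)] that(2) by (simp add: g_def k_def)
  have gnn: "g (\<theta> i) \<ge> 0" if "i < n" for i
    using gpos[OF that] by (cases "\<theta> i = y") (auto simp: g_def)
  have "(\<Sum>i<n. artanh (S * tan (\<theta> i))) = (\<Sum>i<n. g (\<theta> i) + artanh (S * tan y) + k * (\<theta> i - y))"
    by (simp add: g_def)
  also have "\<dots> = (\<Sum>i<n. g (\<theta> i)) + real n * artanh (S * tan y) + k * ((\<Sum>i<n. \<theta> i) - real n * y)"
    by (simp add: sum.distrib sum_distrib_left[symmetric] sum_subtractf)
  finally have eq: "(\<Sum>i<n. artanh (S * tan (\<theta> i)))
    = (\<Sum>i<n. g (\<theta> i)) + real n * artanh (S * tan y) + k * ((\<Sum>i<n. \<theta> i) - real n * y)" .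
  have 0: "k * ((\<Sum>i<n. \<theta> i) - real n * y) \<ge> 0" using k sum by simp
  have 1: "(\<Sum>i<n. g (\<theta> i)) \<ge> 0" by (intro sum_nonneg) (auto intro: gnn)
  show "(\<Sum>i<n. artanh (S * tan (\<theta> i))) \<ge> real n * artanh (S * tan y)" using eq 0 1 by linarith
  show "\<theta> i = y" if "(\<Sum>i<n. artanh (S * tan (\<theta> i))) = real n * artanh (S * tan y)" "i < n"
  proof -
    have "(\<Sum>i<n. g (\<theta> i)) = 0" using eq 0 1 that(1) by linarith
    then have "g (\<theta> i) = 0" using sum_nonneg_eq_0_iff[of "{..<n}" "\<lambda>i. g (\<theta> i)"] gnn that(2) by auto
    then show ?thesis using gpos[OF that(2)] by force
  qed
qed

section \<open>Tangential polygons centred at the origin\<close>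

text \<open>The map \<open>\<lambda>x. q * Complex 1 x\<close> parametrises the line through
  \<open>q\<close> perpendicular to the radius; \<open>x\<close> is the tangent of the signed angle
  at the origin between \<open>q\<close> and the point. All sides are described in this
  coordinate.\<close>

lemma closed_segment_mult_Complex_1:
  "closed_segment (q * Complex 1 a) (q * Complex 1 b) = (\<lambda>x. q * Complex 1 x) ` closed_segment a b"
proof -
  have eq: "(1 - u) *\<^sub>R (q * Complex 1 a) + u *\<^sub>R (q * Complex 1 b) = q * Complex 1 ((1 - u) * a + u * b)" for u
    by (simp add: complex_eq_iff algebra_simps)
  show ?thesis unfolding closed_segment_def eq by auto
qed

lemma norm_Complex_1_sq: "(norm (Complex 1 x))\<^sup>2 = 1 + x\<^sup>2"
  by (simp add: cmod_power2)

lemma Complex_1_polar: "Complex 1 x = of_real (sqrt (1 + x\<^sup>2)) * cis (arctan x)"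
  by (simp add: complex_eq_iff cos_arctan sin_arctan) (metis add_pos_nonneg less_irrefl zero_le_power2 zero_less_one)

lemma one_minus_tanh_sq: "1 - (tanh r)\<^sup>2 = 1 / (cosh (r::real))\<^sup>2"
  using cosh_square_eq[of r] sum_power2_gt_zero_iff[of "sinh r" 1]
  by (simp add: tanh_def power_divide divide_simps)

lemma hdist_0_eq_iff:
  assumes r: "r > 0" and y: "y \<in> ball 0 1"
  shows "hdist 0 y = r \<longleftrightarrow> norm y = tanh r"
proof -
  define N where "N = 1 - (norm y)\<^sup>2"
  have N: "0 < N" "N \<le> 1" using y by (auto simp: N_def abs_square_less_1)
  have one: "1 \<le> 1 / sqrt N" using N by simp
  have "hdist 0 y = arcosh (1 / sqrt N)" by (simp add: hdist_def N_def)
  then have "hdist 0 y = r \<longleftrightarrow> 1 / sqrt N = cosh r"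
    using r one by (metis arcosh_cosh_real cosh_arcosh_real less_imp_le)
  also have "\<dots> \<longleftrightarrow> (1 / sqrt N)\<^sup>2 = (cosh r)\<^sup>2"
    using N by (simp add: power2_eq_iff_nonneg)
  also have "\<dots> \<longleftrightarrow> N = 1 / (cosh r)\<^sup>2"
    using N by (auto simp: power_divide field_simps)
  also have "\<dots> \<longleftrightarrow> (norm y)\<^sup>2 = (tanh r)\<^sup>2"
    using one_minus_tanh_sq[of r] by (auto simp: N_def)
  also have "\<dots> \<longleftrightarrow> norm y = tanh r" using r by (simp add: power2_eq_iff_nonneg)
  finally show ?thesis .
qed

text \<open>Tangency is given as meeting the circle in a single point. It implies that the radius to
  this point is perpendicular to the line, which yields the coordinates;
  \<open>x * y \<le> 0\<close> records that the tangency point lies between the endpoints.\<close>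

lemma segment_tangent_0E:
  assumes r: "r > 0" and a: "a \<in> ball 0 1" and b: "b \<in> ball 0 1" and ab: "a \<noteq> b"
    and tan: "segment_tangent a b 0 r"
  obtains q x y where "norm q = tanh r" "a = q * Complex 1 x" "b = q * Complex 1 y" "x * y \<le> 0"
proof -
  obtain p where p: "p \<in> closed_segment a b" and I: "hline a b \<inter> hcircle 0 r = {p}"
    using tan by (auto simp: segment_tangent_def)
  obtain t where t: "0 \<le> t" "t \<le> 1" and pt: "p = (1 - t) *\<^sub>R a + t *\<^sub>R b"
    using p by (auto simp: closed_segment_def)
  have pb: "p \<in> ball 0 1" and dp: "hdist 0 p = r" using I by (auto simp: hcircle_def)
  have np: "norm p = tanh r" using hdist_0_eq_iff[OF r pb] dp by simp
  define d where "d = b - a"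
  have d: "d \<noteq> 0" using ab by (simp add: d_def)
  \<comment> \<open>With this \<open>m\<close>, the point \<open>z\<close> is the reflection of
    \<open>p\<close> in the foot of the perpendicular from the origin, hence the other intersection
    of the line with the circle. Uniqueness forces \<open>z = p\<close>.\<close>
  define m where "m = 2 * (p \<bullet> d) / (d \<bullet> d)"
  define z where "z = p - m *\<^sub>R d"
  have "z \<bullet> z = p \<bullet> p - 2 * m * (p \<bullet> d) + m * (m * (d \<bullet> d))"
    by (simp add: z_def inner_diff_left inner_diff_right inner_commute algebra_simps)
  also have "m * (d \<bullet> d) = 2 * (p \<bullet> d)" using d by (simp add: m_def)
  finally have "z \<bullet> z = p \<bullet> p" by simp
  then have nz: "norm z = norm p" by (simp add: norm_eq_sqrt_inner)
  then have zb: "z \<in> ball 0 1" using pb by simp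
  have "z = (1 - (t - m)) *\<^sub>R a + (t - m) *\<^sub>R b"
    by (simp add: z_def pt d_def algebra_simps)
  then have "z \<in> affine hull {a, b}" unfolding affine_hull_2 by (metis (mono_tags, lifting) diff_add_cancel mem_Collect_eq)
  then have "z \<in> hline a b \<inter> hcircle 0 r"
    using zb hdist_0_eq_iff[OF r zb] nz np by (simp add: hline_def hcircle_def)
  then have "z = p" using I by blast
  then have "m = 0" using d by (simp add: z_def)
  then have pd: "p \<bullet> d = 0" using d by (simp add: m_def)
  have p0: "p \<noteq> 0" using np r by auto
  define e where "e = Im (d / p)"
  have "Re (d / p) = 0" using pd by (simp add: Re_divide inner_complex_def mult.commute)
  then have "d / p = Complex 0 e" by (simp add: complex_eq_iff e_def)
  then have de: "d = p * Complex 0 e" using p0 by (metis nonzero_mult_div_cancel_left times_divide_eq_right)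
  have "a = p - t *\<^sub>R d" "b = p + (1 - t) *\<^sub>R d" by (simp_all add: pt d_def algebra_simps)
  then have "a = p * Complex 1 (- t * e)" "b = p * Complex 1 ((1 - t) * e)"
    unfolding de by (simp_all add: complex_eq_iff algebra_simps)
  moreover have "(- t * e) * ((1 - t) * e) \<le> 0"
  proof -
    have "(- t * e) * ((1 - t) * e) = - (t * (1 - t) * e\<^sup>2)" by (simp add: power2_eq_square)
    also have "\<dots> \<le> 0" using t by simp
    finally show ?thesis .
  qed
  ultimately show ?thesis using that np by blast
qed

text \<open>After multiplication by \<open>(cosh r)\<^sup>2\<close>, being in the disc is the
  condition that \<open>sinh r * \<bar>x\<bar>\<close> is in the domain of
  \<open>artanh\<close>.\<close>

lemma mult_Complex_1_in_ball:
  assumes r: "r > 0" and q: "norm q = tanh r" and v: "q * Complex 1 x \<in> ball 0 1"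
  shows "sinh r * \<bar>x\<bar> < 1"
proof -
  have "(norm (q * Complex 1 x))\<^sup>2 < 1" using v by (simp add: abs_square_less_1)
  then have "(tanh r)\<^sup>2 * (1 + x\<^sup>2) < 1" by (simp add: norm_mult power_mult_distrib q norm_Complex_1_sq)
  then have "(sinh r)\<^sup>2 * (1 + x\<^sup>2) < (cosh r)\<^sup>2" by (simp add: tanh_def power_divide field_simps)
  then have "(sinh r * \<bar>x\<bar>)\<^sup>2 < 1" by (simp add: cosh_square_eq power_mult_distrib algebra_simps)
  then show ?thesis using r by (simp add: abs_square_less_1)
qed

text \<open>\<open>q i\<close> is the tangency point on the \<open>i\<close>-th side, and \<open>\<tau> i\<close> is the tangent of the
  central angle at the \<open>i\<close>-th vertex between the vertex and a tangency point next to it, signed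
  by the orientation of the polygon; it vanishes at a straight angle.\<close>

locale centred_polygon =
  fixes n :: nat and Q :: "complex list" and r :: real and q :: "nat \<Rightarrow> complex" and \<tau> :: "nat \<Rightarrow> real"
  assumes n3: "n \<ge> 3" and polygon: "hyperbolic_polygon n Q" and r_pos: "r > 0"
    and norm_q: "norm (q i) = tanh r"
    and q_periodic: "q (i + n) = q i" and \<tau>_periodic: "\<tau> (i + n) = \<tau> i"
    and side_start: "vertex Q i = q i * Complex 1 (- \<tau> i)"
    and side_end: "vertex Q (Suc i) = q i * Complex 1 (\<tau> (Suc i))"
    and same_sign: "\<tau> i * \<tau> j \<ge> 0"

lemma vertex_mod: "vertex P (i mod length P) = vertex P i"
  by (simp add: vertex_def)

lemma vertex_Suc_mod: "vertex P (Suc (i mod length P)) = vertex P (Suc i)"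
  by (simp add: vertex_def mod_Suc_eq)

lemma side_mod: "side P (i mod length P) = side P i"
  by (simp add: side_def vertex_mod vertex_Suc_mod)

lemma vertex_eq_iff:
  assumes "hyperbolic_polygon n P" "n > 0"
  shows "vertex P i = vertex P j \<longleftrightarrow> i mod n = j mod n"
  using assms by (auto simp: hyperbolic_polygon_def vertex_def nth_eq_iff_index_eq)

lemma vertex_in_ball:
  assumes "hyperbolic_polygon n P" "n > 0"
  shows "vertex P i \<in> ball 0 1"
proof -
  have "vertex P i \<in> set P" using assms by (auto simp: hyperbolic_polygon_def vertex_def)
  then show ?thesis using assms by (auto simp: hyperbolic_polygon_def)
qed

lemma side_Int_side:
  assumes "hyperbolic_polygon n P" "n > 0" "i mod n \<noteq> j mod n"
  shows "side P i \<inter> side P j = {vertex P i, vertex P (Suc i)} \<inter> {vertex P j, vertex P (Suc j)}"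
proof -
  have "length P = n" using assms by (simp add: hyperbolic_polygon_def)
  then show ?thesis using assms(1,3) mod_less_divisor[OF assms(2)] unfolding hyperbolic_polygon_def
    by (metis side_mod vertex_mod vertex_Suc_mod)
qed

lemma Suc_mod_neq:
  assumes "(n::nat) \<ge> 3"
  shows "i mod n \<noteq> Suc i mod n" "i mod n \<noteq> Suc (Suc i) mod n"
  using assms by (auto simp: mod_Suc split: if_splits)

lemma side_Int_side_Suc:
  assumes P: "hyperbolic_polygon n P" and n: "n \<ge> 3"
  shows "side P i \<inter> side P (Suc i) = {vertex P (Suc i)}"
  using side_Int_side[OF P, of i "Suc i"] vertex_eq_iff[OF P] Suc_mod_neq[OF n] n by auto

text \<open>Consecutive half-sides turn in the same direction around the centre: otherwise two
  consecutive sides would overlap.\<close>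

lemma centred_polygon_exists:
  assumes n: "n \<ge> 3" and P: "hyperbolic_polygon n Q" and inc: "incircle Q 0 r"
  shows "\<exists>q \<tau>. centred_polygon n Q r q \<tau>"
proof -
  have r: "r > 0" using inc by (simp add: incircle_def)
  have n0: "n > 0" using n by simp
  have len: "length Q = n" using P by (simp add: hyperbolic_polygon_def)
  note veq = vertex_eq_iff[OF P n0]
  have "\<exists>q x y. norm q = tanh r \<and> vertex Q i = q * Complex 1 x \<and> vertex Q (Suc i) = q * Complex 1 y \<and> x * y \<le> 0"
    if "i < n" for i
    using segment_tangent_0E[OF r vertex_in_ball[OF P n0] vertex_in_ball[OF P n0], of i "Suc i"]
      veq[of i "Suc i"] Suc_mod_neq[OF n, of i] inc that len unfolding incircle_def by metis
  then obtain q' x' y' where *: "\<And>i. i < n \<Longrightarrow> norm (q' i) = tanh r \<and> vertex Q i = q' i * Complex 1 (x' i) \<and>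
     vertex Q (Suc i) = q' i * Complex 1 (y' i) \<and> x' i * y' i \<le> (0::real)" by metis
  define q where "q = (\<lambda>i. q' (i mod n))"
  define x where "x = (\<lambda>i. x' (i mod n))"
  define y where "y = (\<lambda>i. y' (i mod n))"
  have nq: "norm (q i) = tanh r" and vx: "vertex Q i = q i * Complex 1 (x i)"
    and vy: "vertex Q (Suc i) = q i * Complex 1 (y i)" and xy: "x i * y i \<le> 0" for i
    using *[OF mod_less_divisor[OF n0, of i]] vertex_mod[of Q i] vertex_Suc_mod[of Q i]
    by (auto simp: q_def x_def y_def len)
  have q0: "q i \<noteq> 0" for i using nq[of i] r by auto
  have side: "side Q i = (\<lambda>z. q i * Complex 1 z) ` closed_segment (x i) (y i)" for i
    unfolding side_def vy unfolding vx closed_segment_mult_Complex_1 ..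
  have Int: "side Q i \<inter> side Q (Suc i) = {vertex Q (Suc i)}" for i
    by (rule side_Int_side_Suc[OF P n])
  have mid: "q i \<in> side Q i" for i
  proof -
    have "0 \<in> closed_segment (x i) (y i)" using xy[of i]
      by (auto simp: closed_segment_eq_real_ivl mult_le_0_iff)
    moreover have "Complex 1 0 = 1" by (simp add: complex_eq_iff)
    ultimately show ?thesis unfolding side by (intro image_eqI[where x = 0]) simp_all
  qed
  have vne: "vertex Q i \<noteq> vertex Q (Suc i)" for i
    unfolding veq by (rule Suc_mod_neq[OF n])
  then have xney: "x i \<noteq> y i" for i unfolding vy unfolding vx by metis
  \<comment> \<open>Both expressions for the common vertex have the same norm, so the coordinates
    agree up to sign. Equal nonzero coordinates would make the two tangency points coincide; this
    point would lie on both sides without being their common vertex.\<close>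
  have glue: "x (Suc i) = - y i" for i
  proof -
    have eq: "q i * Complex 1 (y i) = q (Suc i) * Complex 1 (x (Suc i))" using vx[of "Suc i"] vy[of i] by simp
    then have "(norm (q i * Complex 1 (y i)))\<^sup>2 = (norm (q (Suc i) * Complex 1 (x (Suc i))))\<^sup>2" by simp
    then have "(y i)\<^sup>2 = (x (Suc i))\<^sup>2" using r
      by (simp add: norm_mult power_mult_distrib nq norm_Complex_1_sq)
    then consider "x (Suc i) = - y i" | "x (Suc i) = y i" "y i \<noteq> 0" by (cases "y i = 0") (auto simp: power2_eq_iff)
    then show ?thesis
    proof cases
      case 2
      then have "q i = q (Suc i)" using eq by (simp add: complex_eq_iff[of _ 0])
      then have "q i \<in> side Q i \<inter> side Q (Suc i)" using mid[of i] mid[of "Suc i"] by simp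
      then have "q i = vertex Q (Suc i)" unfolding Int by simp
      then have "q i * Complex 1 (y i) = q i * 1" unfolding vy by simp
      then have "Complex 1 (y i) = 1" using q0[of i] by (simp only: mult_left_cancel simp_thms)
      then show ?thesis using 2 by (simp add: complex_eq_iff)
    qed
  qed
  \<comment> \<open>If the common vertex is itself the tangency point, both sides lie on the same
    tangent line. They must leave it in opposite directions, since otherwise one would contain the
    far endpoint of the other.\<close>
  have straight: "x i * y (Suc i) < 0" if y0: "y i = 0" for i
  proof (rule ccontr)
    assume neg: "\<not> ?thesis"
    have x0: "x (Suc i) = 0" using glue y0 by simp
    have one: "Complex 1 0 = 1" by (simp add: complex_eq_iff)
    have qq: "q i = q (Suc i)" using vx[of "Suc i"] vy[of i] x0 y0 one by simp
    have "x i \<noteq> 0" "y (Suc i) \<noteq> 0" using xney[of i] xney[of "Suc i"] x0 y0 by auto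
    with neg have pos: "x i * y (Suc i) > 0" by (simp add: not_less less_le)
    have "x i \<in> closed_segment 0 (y (Suc i)) \<or> y (Suc i) \<in> closed_segment (x i) 0"
      using pos by (auto simp: closed_segment_eq_real_ivl zero_less_mult_iff)
    then show False
    proof
      assume "x i \<in> closed_segment 0 (y (Suc i))"
      then have "vertex Q i \<in> side Q (Suc i)" unfolding side vx[of i] x0 qq by blast
      moreover have "vertex Q i \<in> side Q i" by (simp add: side_def)
      ultimately have "vertex Q i \<in> {vertex Q (Suc i)}" unfolding Int[of i, symmetric] by simp
      then show False using vne[of i] by simp
    next
      assume "y (Suc i) \<in> closed_segment (x i) 0"
      then have "vertex Q (Suc (Suc i)) \<in> side Q i" unfolding side vy[of "Suc i"] y0 qq by blast
      moreover have "vertex Q (Suc (Suc i)) \<in> side Q (Suc i)" by (simp add: side_def)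
      ultimately have "vertex Q (Suc (Suc i)) \<in> {vertex Q (Suc i)}" unfolding Int[of i, symmetric] by simp
      then show False using vne[of "Suc i"] by simp
    qed
  qed
  define \<tau> where "\<tau> = (\<lambda>i. - x i)"
  have y\<tau>: "y i = \<tau> (Suc i)" for i using glue[of i] by (simp add: \<tau>_def)
  have adj: "\<tau> i * \<tau> (Suc i) \<ge> 0" for i using xy[of i] by (simp add: y\<tau> \<tau>_def)
  have skip: "\<tau> i * \<tau> (Suc (Suc i)) > 0" if "\<tau> (Suc i) = 0" for i
    using straight[of i] that by (simp add: y\<tau> \<tau>_def)
  \<comment> \<open>A single \<open>\<tau> i\<close> may vanish, and then its sign cannot be passed
    on. The sum of two neighbours never vanishes, and its sign survives a straight angle.\<close>
  define g where "g = (\<lambda>i. \<tau> i + \<tau> (Suc i))"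
  have step: "sgn (g (Suc i)) = sgn (g i)" for i
  proof -
    have "sgn (a + b) = sgn (b + d)" if "a * b \<ge> 0" "b * d \<ge> 0" "b = 0 \<Longrightarrow> a * d > 0" for a b d :: real
    proof (cases b "0::real" rule: linorder_cases)
      case less
      then have "a \<le> 0" "d \<le> 0" using that by (auto simp: zero_le_mult_iff)
      then show ?thesis using less by (simp add: sgn_if)
    next
      case equal
      then show ?thesis using that(3) by (auto simp: sgn_if zero_less_mult_iff)
    next
      case greater
      then have "a \<ge> 0" "d \<ge> 0" using that by (auto simp: zero_le_mult_iff)
      then show ?thesis using greater by (simp add: sgn_if)
    qed
    from this[OF adj adj skip] show ?thesis by (simp add: g_def)
  qed
  have g: "sgn (g i) = sgn (g 0)" for i by (induction i) (simp_all add: step)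
  have nonneg: "sgn (g 0) * \<tau> i \<ge> 0" for i
  proof -
    have "sgn (a + b) * a \<ge> 0" if "a * b \<ge> 0" for a b :: real
      using that by (cases a "0::real" rule: linorder_cases) (auto simp: sgn_if zero_le_mult_iff)
    from this[OF adj[of i]] have "sgn (g i) * \<tau> i \<ge> 0" by (simp only: g_def)
    then show ?thesis unfolding g[of i] .
  qed
  have "g 0 \<noteq> 0" using xney[of 0] glue[of 0] by (simp add: g_def \<tau>_def)
  then have "sgn (g 0) * sgn (g 0) = 1" by (simp add: sgn_mult_self_eq)
  then have sgn: "\<tau> i * \<tau> j \<ge> 0" for i j
    using mult_nonneg_nonneg[OF nonneg[of i] nonneg[of j]] by (metis mult.commute mult.left_commute mult_1)
  show ?thesis
  proof (intro exI)
    show "centred_polygon n Q r q \<tau>"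
    proof
      show "vertex Q i = q i * Complex 1 (- \<tau> i)" for i using vx by (simp add: \<tau>_def)
      show "vertex Q (Suc i) = q i * Complex 1 (\<tau> (Suc i))" for i using vy by (simp add: y\<tau>)
    qed (use n P r nq sgn in \<open>auto simp: q_def \<tau>_def x_def\<close>)
  qed
qed

section \<open>Side lengths and the total central angle\<close>

lemma cosh_artanh_real: "\<bar>u\<bar> < 1 \<Longrightarrow> cosh (artanh u) = 1 / sqrt (1 - (u::real)\<^sup>2)"
  and sinh_artanh_real: "\<bar>u\<bar> < 1 \<Longrightarrow> sinh (artanh u) = u / sqrt (1 - (u::real)\<^sup>2)"
proof -
  assume u: "\<bar>u\<bar> < 1"
  define p where "p = sqrt (1 + u)"
  define m where "m = sqrt (1 - u)"
  have pm: "p > 0" "m > 0" "p\<^sup>2 = 1 + u" "m\<^sup>2 = 1 - u" using u by (auto simp: p_def m_def)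
  have "sqrt (1 - u\<^sup>2) = sqrt ((1 + u) * (1 - u))" by (simp add: power2_eq_square algebra_simps)
  then have s: "sqrt (1 - u\<^sup>2) = p * m" by (simp add: real_sqrt_mult p_def m_def)
  have "exp (artanh u) = sqrt (exp (2 * artanh u))" by (simp add: exp_double)
  also have "exp (2 * artanh u) = (1 + u) / (1 - u)" using u by (simp add: artanh_def)
  finally have e: "exp (artanh u) = p / m" by (simp add: real_sqrt_divide p_def m_def)
  have e': "exp (- artanh u) = m / p" using e by (simp add: exp_minus)
  have "cosh (artanh u) = (p / m + m / p) / 2" by (simp add: cosh_field_def e e')
  also have "\<dots> = (p\<^sup>2 + m\<^sup>2) / 2 / (p * m)" using pm by (simp add: field_simps power2_eq_square)
  finally show "cosh (artanh u) = 1 / sqrt (1 - u\<^sup>2)" by (simp add: s pm)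
  have "sinh (artanh u) = (p / m - m / p) / 2" by (simp add: sinh_field_def e e')
  also have "\<dots> = (p\<^sup>2 - m\<^sup>2) / 2 / (p * m)" using pm by (simp add: field_simps power2_eq_square)
  finally show "sinh (artanh u) = u / sqrt (1 - u\<^sup>2)" by (simp add: s pm)
qed

lemma artanh_nonneg: "0 \<le> u \<Longrightarrow> u < 1 \<Longrightarrow> 0 \<le> artanh (u::real)"
  by (simp add: artanh_def)

lemma inner_mult_same: "(q * a) \<bullet> (q * b) = (norm q)\<^sup>2 * (a \<bullet> (b :: complex))"
  by (simp add: inner_complex_def cmod_power2) algebra

text \<open>The condition \<open>0 \<le> x * y\<close> places the tangency point between the two
  ends, so the lengths add. In terms of \<open>u\<close> and \<open>v\<close> the argument of
  \<open>arcosh\<close> is the addition formula for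
  \<open>cosh (artanh u + artanh v)\<close>.\<close>

lemma hdist_tangent_points:
  assumes r: "r > 0" and q: "norm q = tanh r" and xy: "0 \<le> x * y"
    and x: "sinh r * \<bar>x\<bar> < 1" and y: "sinh r * \<bar>y\<bar> < 1"
  shows "hdist (q * Complex 1 (- x)) (q * Complex 1 y) = artanh (sinh r * \<bar>x\<bar>) + artanh (sinh r * \<bar>y\<bar>)"
proof -
  define u where "u = sinh r * \<bar>x\<bar>"
  define v where "v = sinh r * \<bar>y\<bar>"
  have u: "0 \<le> u" "u < 1" and v: "0 \<le> v" "v < 1" using r x y by (auto simp: u_def v_def)
  have u2: "1 - u\<^sup>2 > 0" and v2: "1 - v\<^sup>2 > 0" using u v by (auto simp: abs_square_less_1)
  have C: "cosh r > 0" by simp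
  have "u * v = (sinh r)\<^sup>2 * \<bar>x * y\<bar>" by (simp add: u_def v_def power2_eq_square abs_mult)
  then have uv: "u * v = (sinh r)\<^sup>2 * (x * y)" using xy by simp
  have nn: "1 - (norm (q * Complex 1 z))\<^sup>2 = (1 - (sinh r * \<bar>z\<bar>)\<^sup>2) / (cosh r)\<^sup>2" for z
  proof -
    have "1 - (norm (q * Complex 1 z))\<^sup>2 = ((cosh r)\<^sup>2 - (sinh r)\<^sup>2 * (1 + z\<^sup>2)) / (cosh r)\<^sup>2"
      by (simp add: norm_mult power_mult_distrib q norm_Complex_1_sq tanh_def power_divide diff_divide_distrib)
    also have "(cosh r)\<^sup>2 - (sinh r)\<^sup>2 * (1 + z\<^sup>2) = 1 - (sinh r * \<bar>z\<bar>)\<^sup>2"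
      by (simp add: cosh_square_eq power_mult_distrib algebra_simps)
    finally show ?thesis .
  qed
  have in': "1 - (q * Complex 1 (- x)) \<bullet> (q * Complex 1 y) = (1 + u * v) / (cosh r)\<^sup>2"
  proof -
    have "1 - (q * Complex 1 (- x)) \<bullet> (q * Complex 1 y) = ((cosh r)\<^sup>2 - (sinh r)\<^sup>2 * (1 - x * y)) / (cosh r)\<^sup>2"
      unfolding inner_mult_same by (simp add: q inner_complex_def tanh_def power_divide diff_divide_distrib)
    also have "(cosh r)\<^sup>2 - (sinh r)\<^sup>2 * (1 - x * y) = 1 + u * v"
      by (simp add: cosh_square_eq uv algebra_simps)
    finally show ?thesis .
  qed
  have "sqrt ((1 - (norm (q * Complex 1 (- x)))\<^sup>2) * (1 - (norm (q * Complex 1 y))\<^sup>2))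
      = sqrt (1 - u\<^sup>2) * sqrt (1 - v\<^sup>2) / (cosh r)\<^sup>2"
    unfolding nn using C by (simp add: u_def v_def real_sqrt_mult real_sqrt_divide power2_eq_square)
  then have "hdist (q * Complex 1 (- x)) (q * Complex 1 y)
      = arcosh ((1 + u * v) / (sqrt (1 - u\<^sup>2) * sqrt (1 - v\<^sup>2)))"
    unfolding hdist_def in' by simp
  also have "(1 + u * v) / (sqrt (1 - u\<^sup>2) * sqrt (1 - v\<^sup>2)) = cosh (artanh u + artanh v)"
    using u v by (simp add: cosh_add cosh_artanh_real sinh_artanh_real add_divide_distrib)
  also have "arcosh \<dots> = artanh u + artanh v"
    using u v by (intro arcosh_cosh_real add_nonneg_nonneg artanh_nonneg)
  finally show ?thesis by (simp add: u_def v_def)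
qed

lemma klein_metric_scaleR: "klein_metric v (a *\<^sub>R x) (b *\<^sub>R y) = a * b * klein_metric v x y"
  by (simp add: klein_metric_def algebra_simps)

context centred_polygon
begin

lemma n_pos: "n > 0" using n3 by simp

lemma length_Q: "length Q = n" using polygon by (simp add: hyperbolic_polygon_def)

lemma q_nonzero: "q i \<noteq> 0"
  using norm_q[of i] r_pos by auto

lemma vertex_neq_Suc: "vertex Q i \<noteq> vertex Q (Suc i)"
  unfolding vertex_eq_iff[OF polygon n_pos] by (rule Suc_mod_neq[OF n3])

lemma \<tau>_add_nonzero: "\<tau> i + \<tau> (Suc i) \<noteq> 0"
  using vertex_neq_Suc[of i] unfolding side_end unfolding side_start
  by (metis add.right_inverse add_left_cancel)

lemma \<tau>_small: "sinh r * \<bar>\<tau> i\<bar> < 1"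
  using mult_Complex_1_in_ball[OF r_pos norm_q, of i "- \<tau> i"] vertex_in_ball[OF polygon n_pos, of i]
  by (simp add: side_start)

lemma side_length_eq: "side_length Q i = artanh (sinh r * \<bar>\<tau> i\<bar>) + artanh (sinh r * \<bar>\<tau> (Suc i)\<bar>)"
  unfolding side_length_def side_end unfolding side_start
  by (rule hdist_tangent_points[OF r_pos norm_q same_sign \<tau>_small \<tau>_small])

lemma sum_rotate:
  fixes f :: "real \<Rightarrow> real"
  shows "(\<Sum>i<n. f (\<tau> (Suc i))) = (\<Sum>i<n. f (\<tau> i))"
  using sum.lessThan_Suc_shift[of "\<lambda>i. f (\<tau> i)" n] sum.lessThan_Suc[of "\<lambda>i. f (\<tau> i)" n] \<tau>_periodic[of 0]
  by simp

lemma Peri_eq: "Peri Q = 2 * (\<Sum>i<n. artanh (sinh r * \<bar>\<tau> i\<bar>))"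
  using sum_rotate[of "\<lambda>t. artanh (sinh r * \<bar>t\<bar>)"]
  by (simp add: Peri_def length_Q side_length_eq sum.distrib)

text \<open>The common vertex is seen at the angle \<open>arctan (\<tau> (Suc i))\<close> after one
  tangency point and before the next, so the tangency point turns by twice this angle.\<close>

lemma q_Suc: "q (Suc i) = q i * cis (2 * arctan (\<tau> (Suc i)))"
proof -
  let ?t = "\<tau> (Suc i)"
  have "q (Suc i) * Complex 1 (- ?t) = q i * Complex 1 ?t" using side_start[of "Suc i"] side_end[of i] by simp
  then have "q (Suc i) * cis (- arctan ?t) = q i * cis (arctan ?t)"
    by (simp add: Complex_1_polar[of ?t] Complex_1_polar[of "- ?t"] arctan_minus add_nonneg_eq_0_iff)
  then have "q (Suc i) * cis (- arctan ?t) * cis (arctan ?t) = q i * cis (arctan ?t) * cis (arctan ?t)" by simp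
  then show ?thesis by (simp add: mult.assoc cis_mult)
qed

lemma q_eq: "q i = q 0 * cis (2 * (\<Sum>j<i. arctan (\<tau> (Suc j))))"
  by (induction i) (simp_all add: q_Suc mult.assoc cis_mult algebra_simps)

text \<open>After \<open>n\<close> sides the tangency point is back where it started, so the total
  rotation is trivial; \<open>k\<close> counts the signed turns around the centre.\<close>

lemma sum_arctan: "\<exists>k::int. (\<Sum>i<n. arctan (\<tau> i)) = of_int k * pi"
proof -
  have "q 0 * cis (2 * (\<Sum>i<n. arctan (\<tau> i))) = q 0 * 1"
    using q_eq[of n] q_periodic[of 0] sum_rotate[of arctan] by simp
  then have "cis (2 * (\<Sum>i<n. arctan (\<tau> i))) = 1" using q_nonzero[of 0] by (simp only: mult_left_cancel simp_thms)
  then have "cos (2 * (\<Sum>i<n. arctan (\<tau> i))) = 1" by (simp add: complex_eq_iff)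
  then show ?thesis unfolding cos_one_2pi_int by (auto simp: mult.commute)
qed

lemma sum_abs_arctan: "(\<Sum>i<n. arctan \<bar>\<tau> i\<bar>) = \<bar>\<Sum>i<n. arctan (\<tau> i)\<bar>"
proof (cases "\<exists>j. \<tau> j > 0")
  case True
  then have "\<tau> i \<ge> 0" for i using same_sign[of i] by (auto simp: zero_le_mult_iff) (metis less_le_not_le order_less_imp_le)
  then show ?thesis by (simp add: sum_nonneg)
next
  case False
  then have "\<tau> i \<le> 0" for i by (meson linorder_not_less)
  then have "arctan \<bar>\<tau> i\<bar> = - arctan (\<tau> i)" "arctan (\<tau> i) \<le> 0" for i by (auto simp: arctan_minus)
  then show ?thesis by (simp add: sum_negf sum_nonpos)
qed

text \<open>Two neighbouring \<open>\<tau>\<close> cannot both vanish, so the integer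
  \<open>k\<close> is nonzero. Several turns remain possible at this stage.\<close>

lemma sum_abs_arctan_ge: "(\<Sum>i<n. arctan \<bar>\<tau> i\<bar>) \<ge> pi"
proof -
  obtain k :: int where k: "(\<Sum>i<n. arctan (\<tau> i)) = of_int k * pi" using sum_arctan by blast
  have "\<tau> 0 \<noteq> 0 \<or> \<tau> 1 \<noteq> 0" using \<tau>_add_nonzero[of 0] by auto
  then obtain j where j: "j < n" "\<tau> j \<noteq> 0" using n3 by (metis less_le_trans zero_less_numeral one_less_numeral_iff semiring_norm(77))
  then have "0 < (\<Sum>i<n. arctan \<bar>\<tau> i\<bar>)" by (intro sum_pos2[of _ j]) auto
  then have "k \<noteq> 0" by (auto simp: sum_abs_arctan k)
  then have "1 \<le> \<bar>real_of_int k\<bar>" by linarith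
  then show ?thesis unfolding sum_abs_arctan k by (simp add: abs_mult)
qed

text \<open>Since every vertex lies in the disc, failure of the inequality would push every
  half-angle below \<open>pi / n\<close> and their sum below \<open>pi\<close>.\<close>

lemma tan_pi_n_sinh_less_1: "sinh r * tan (pi / n) < 1"
proof (rule ccontr)
  assume neg: "\<not> ?thesis"
  have pn: "pi / n < pi / 2" using n3 by (simp add: field_simps)
  have "arctan \<bar>\<tau> i\<bar> < pi / n" for i
  proof -
    have "sinh r * \<bar>\<tau> i\<bar> < sinh r * tan (pi / n)" using \<tau>_small[of i] neg by linarith
    then have "\<bar>\<tau> i\<bar> < tan (pi / n)" using r_pos by simp
    then have "arctan \<bar>\<tau> i\<bar> < arctan (tan (pi / n))" by (rule arctan_monotone)
    also have "\<dots> = pi / n" using pn n_pos by (intro arctan_tan) (auto intro: less_trans[of _ 0])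
    finally show ?thesis .
  qed
  then have "(\<Sum>i<n. arctan \<bar>\<tau> i\<bar>) < (\<Sum>i<n. pi / n)" using n_pos by (intro sum_strict_mono) auto
  also have "\<dots> = pi" using n_pos by simp
  finally show False using sum_abs_arctan_ge by simp
qed

text \<open>In the right triangle of centre, vertex and tangency point, the half-angle
  \<open>\<alpha>\<close> at the vertex and the angle \<open>\<theta>\<close> at the centre satisfy
  \<open>cos \<alpha> = cosh r * sin \<theta>\<close>. The formula is
  \<open>cos (2 * \<alpha>)\<close> with \<open>(sin \<theta>)\<^sup>2 = T / (1 + T)\<close>,
  obtained here by computing with the metric.\<close>

lemma hangle_eq:
  fixes i :: nat
  defines "T \<equiv> (\<tau> (Suc i))\<^sup>2"
  shows "hangle (vertex Q i) (vertex Q (Suc i)) (vertex Q (Suc (Suc i)))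
     = arccos (2 * (cosh r)\<^sup>2 * (T / (1 + T)) - 1)"
proof -
  define t where "t = \<tau> (Suc i)"
  define \<rho> where "\<rho> = (tanh r)\<^sup>2"
  define w where "w = vertex Q (Suc i)"
  define D where "D = q (Suc i) * \<i>"
  define E where "E = q i * \<i>"
  define d where "d = t + \<tau> (Suc (Suc i))"
  define e where "e = \<tau> i + t"
  define B where "B = 1 - \<rho> * (1 + t\<^sup>2)"
  have w1: "w = q i * Complex 1 t" and w2: "w = q (Suc i) * Complex 1 (- t)"
    using side_end[of i] side_start[of "Suc i"] by (auto simp: w_def t_def)
  have nw: "(norm w)\<^sup>2 = \<rho> * (1 + t\<^sup>2)"
    unfolding w1 by (simp add: norm_mult power_mult_distrib norm_q norm_Complex_1_sq \<rho>_def)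
  have B: "B > 0" using vertex_in_ball[OF polygon n_pos, of "Suc i"] nw
    by (simp add: B_def w_def[symmetric] abs_square_less_1 flip: nw)
  have b: "vertex Q (Suc (Suc i)) - w = d *\<^sub>R D"
    unfolding w2 side_end by (simp add: d_def D_def t_def complex_eq_iff algebra_simps)
  have a: "vertex Q i - w = (- e) *\<^sub>R E"
    unfolding w1 side_start by (simp add: e_def E_def t_def complex_eq_iff algebra_simps)
  \<comment> \<open>Both \<open>e\<close> and \<open>d\<close> are sums of neighbouring
    \<open>\<tau>\<close>, so the common sign makes \<open>e * d\<close> positive in either
    orientation. This removes the absolute value when the square root is taken.\<close>
  have "\<tau> i * \<tau> (Suc (Suc i)) \<ge> 0" "\<tau> i * t \<ge> 0" "t * \<tau> (Suc (Suc i)) \<ge> 0" "t * t \<ge> 0"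
    using same_sign by (auto simp: t_def)
  then have "e * d \<ge> 0" by (simp add: e_def d_def algebra_simps)
  moreover have "e \<noteq> 0" "d \<noteq> 0" using \<tau>_add_nonzero[of i] \<tau>_add_nonzero[of "Suc i"] by (auto simp: e_def d_def t_def)
  ultimately have ed: "e * d > 0" by (simp add: less_le)
  have wD: "w \<bullet> D = - (\<rho> * t)" unfolding w2 D_def inner_mult_same by (simp add: norm_q \<rho>_def inner_complex_def)
  have wE: "w \<bullet> E = \<rho> * t" unfolding w1 E_def inner_mult_same by (simp add: norm_q \<rho>_def inner_complex_def)
  have DD: "D \<bullet> D = \<rho>" unfolding D_def inner_mult_same by (simp add: norm_q \<rho>_def)
  have EE: "E \<bullet> E = \<rho>" unfolding E_def inner_mult_same by (simp add: norm_q \<rho>_def)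
  have "E \<bullet> D = (q i * \<i>) \<bullet> (q i * (cis (2 * arctan t) * \<i>))" by (simp add: E_def D_def q_Suc t_def mult.assoc)
  also have "\<dots> = \<rho> * cos (2 * arctan t)" unfolding inner_mult_same by (simp add: norm_q \<rho>_def inner_complex_def)
  also have "cos (2 * arctan t) = (1 - t\<^sup>2) / (1 + t\<^sup>2)"
    by (simp add: cos_double cos_arctan sin_arctan power_divide diff_divide_distrib[symmetric])
  finally have ED: "E \<bullet> D = \<rho> * ((1 - t\<^sup>2) / (1 + t\<^sup>2))" .
  have \<rho>: "\<rho> > 0" using r_pos by (simp add: \<rho>_def)
  have \<rho>1: "1 - \<rho> = 1 / (cosh r)\<^sup>2" by (simp add: \<rho>_def one_minus_tanh_sq)
  have kDD: "klein_metric w D D = \<rho> * (1 - \<rho>) / B\<^sup>2" and kEE: "klein_metric w E E = \<rho> * (1 - \<rho>) / B\<^sup>2"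
  proof -
    have "\<rho> / B + \<rho> * t * (\<rho> * t) / B\<^sup>2 = (\<rho> * B + \<rho> * t * (\<rho> * t)) / B\<^sup>2"
      using B by (simp add: add_divide_distrib power2_eq_square)
    also have "\<rho> * B + \<rho> * t * (\<rho> * t) = \<rho> * (1 - \<rho>)" unfolding B_def by algebra
    finally show "klein_metric w D D = \<rho> * (1 - \<rho>) / B\<^sup>2" "klein_metric w E E = \<rho> * (1 - \<rho>) / B\<^sup>2"
      unfolding klein_metric_def nw B_def[symmetric] wD wE DD EE by simp_all
  qed
  define N where "N = \<rho> * t\<^sup>2 - (1 - t\<^sup>2) / (1 + t\<^sup>2) * B"
  have kED: "klein_metric w E D = - (\<rho> * N / B\<^sup>2)"
  proof -
    have "klein_metric w E D = \<rho> * ((1 - t\<^sup>2) / (1 + t\<^sup>2)) / B - \<rho> * t * (\<rho> * t) / B\<^sup>2"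
      unfolding klein_metric_def nw B_def[symmetric] wD wE ED by simp
    also have "\<dots> = (\<rho> * ((1 - t\<^sup>2) / (1 + t\<^sup>2)) * B - \<rho> * t * (\<rho> * t)) / B\<^sup>2"
      using B by (simp add: diff_divide_distrib power2_eq_square)
    also have "\<rho> * ((1 - t\<^sup>2) / (1 + t\<^sup>2)) * B - \<rho> * t * (\<rho> * t) = - (\<rho> * N)"
      by (simp add: N_def algebra_simps power2_eq_square)
    finally show ?thesis by simp
  qed
  have "1 + t\<^sup>2 \<noteq> 0" by (metis add_pos_nonneg less_irrefl zero_le_power2 zero_less_one)
  then have N: "N = 2 * (t\<^sup>2 / (1 + t\<^sup>2)) - (1 - \<rho>)"
    unfolding N_def B_def by (simp add: divide_simps) algebra
  let ?K = "\<rho> * (1 - \<rho>) / B\<^sup>2"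
  have "1 - \<rho> > 0" unfolding \<rho>1 by simp
  then have K: "?K > 0" using \<rho> B by simp
  have "hangle (vertex Q i) w (vertex Q (Suc (Suc i))) =
      arccos ((- e) * d * klein_metric w E D / sqrt (((- e) * (- e) * ?K) * (d * d * ?K)))"
    unfolding hangle_def a b klein_metric_scaleR kDD kEE ..
  also have "((- e) * (- e) * ?K) * (d * d * ?K) = (e * d * ?K)\<^sup>2" by (simp add: power2_eq_square)
  also have "sqrt ((e * d * ?K)\<^sup>2) = e * d * ?K"
    using mult_pos_pos[OF ed K] by (simp only: real_sqrt_abs abs_of_pos)
  also have "(- e) * d * klein_metric w E D / (e * d * ?K) = (e * d * (\<rho> * N / B\<^sup>2)) / (e * d * ?K)"
    unfolding kED by simp
  also have "\<dots> = (\<rho> / B\<^sup>2 * N) / (\<rho> / B\<^sup>2 * (1 - \<rho>))"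
    using less_imp_neq[OF ed] by (simp add: mult.assoc[symmetric])
  also have "\<dots> = N / (1 - \<rho>)" using \<rho> B by simp
  also have "\<dots> = N * (cosh r)\<^sup>2" unfolding \<rho>1 by simp
  also have "\<dots> = 2 * (cosh r)\<^sup>2 * (t\<^sup>2 / (1 + t\<^sup>2)) - 1" unfolding N \<rho>1 by (simp add: algebra_simps)
  finally show ?thesis by (simp add: w_def T_def t_def)
qed

end

text \<open>An odd multiple of \<open>pi / n\<close> stays at distance at least
  \<open>pi / n\<close> from every multiple of \<open>2 * pi\<close>. Such multiples are the angles
  between vertices and tangency points in the regular polygon.\<close>

lemma cos_odd_pi_div_le:
  assumes n: "n > 0"
  shows "cos (of_int (2 * m + 1) * (pi / real n)) \<le> cos (pi / real n)"
proof -
  define k where "k = m mod int n"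
  define d where "d = m div int n"
  have k: "0 \<le> k" "k < int n" using n by (auto simp: k_def)
  have m: "m = int n * d + k" by (simp add: k_def d_def)
  define x where "x = of_int (2 * k + 1) * (pi / real n)"
  have "of_int (2 * m + 1) * (pi / real n) = x + 2 * pi * of_int d"
    using n by (simp add: m x_def field_simps)
  then have "cos (of_int (2 * m + 1) * (pi / real n)) = cos x"
    by (simp add: cos_add)
  also have "cos x \<le> cos (pi / real n)"
  proof -
    have "1 * (pi / real n) \<le> of_int (2 * k + 1) * (pi / real n)"
      using k n by (intro mult_right_mono) auto
    then have x1: "pi / real n \<le> x" by (simp add: x_def)
    have "of_int (2 * k + 1) * (pi / real n) \<le> (2 * real n - 1) * (pi / real n)"
      using k by (intro mult_right_mono) (linarith, simp)
    also have "\<dots> = 2 * pi - pi / real n" using n by (simp add: field_simps)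
    finally have x2: "x \<le> 2 * pi - pi / real n" by (simp add: x_def)
    show ?thesis
    proof (cases "x \<le> pi")
      case True
      then show ?thesis using x1 by (intro cos_monotone_0_pi_le) auto
    next
      case False
      then have "cos (2 * pi - x) \<le> cos (pi / real n)" using x2 by (intro cos_monotone_0_pi_le) auto
      then show ?thesis by (simp add: cos_diff)
    qed
  qed
  finally show ?thesis .
qed

section \<open>Interior angles, and the inequality for centred polygons\<close>

context centred_polygon
begin

lemma interior_hangle_eq:
  "hangle (vertex Q (i + n - 1)) (vertex Q i) (vertex Q (Suc i))
     = arccos (2 * (cosh r)\<^sup>2 * ((\<tau> i)\<^sup>2 / (1 + (\<tau> i)\<^sup>2)) - 1)"
proof -
  have S: "Suc (i + n - 1) = i + n" using n_pos by simp
  have "vertex Q (i + n) = vertex Q i" "vertex Q (Suc (i + n)) = vertex Q (Suc i)"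
    unfolding vertex_eq_iff[OF polygon n_pos] by (simp_all add: mod_Suc)
  then show ?thesis using hangle_eq[of "i + n - 1"] unfolding S \<tau>_periodic by simp
qed

text \<open>On this range \<open>arccos\<close> is injective and at most \<open>pi\<close>. The
  upper bound holds because the vertex lies in the disc.\<close>

lemma interior_hangle_cos_bounds: "\<bar>2 * (cosh r)\<^sup>2 * ((\<tau> i)\<^sup>2 / (1 + (\<tau> i)\<^sup>2)) - 1\<bar> \<le> 1"
proof -
  have "(sinh r * \<bar>\<tau> i\<bar>)\<^sup>2 < 1" using \<tau>_small[of i] r_pos by (simp add: abs_square_less_1 abs_mult)
  then have "(cosh r)\<^sup>2 * (\<tau> i)\<^sup>2 \<le> 1 + (\<tau> i)\<^sup>2"
    by (simp add: power_mult_distrib cosh_square_eq algebra_simps)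
  then have "(cosh r)\<^sup>2 * ((\<tau> i)\<^sup>2 / (1 + (\<tau> i)\<^sup>2)) \<le> 1" by (simp add: divide_le_eq add_pos_nonneg)
  moreover have "0 \<le> (cosh r)\<^sup>2 * ((\<tau> i)\<^sup>2 / (1 + (\<tau> i)\<^sup>2))" by simp
  ultimately show ?thesis unfolding mult.assoc abs_le_iff by linarith
qed

lemma interior_hangle_le_pi: "hangle (vertex Q (i + n - 1)) (vertex Q i) (vertex Q (Suc i)) \<le> pi"
  using interior_hangle_cos_bounds[of i] unfolding interior_hangle_eq abs_le_iff by (intro arccos_ubound) linarith+

lemma interior_hangle_inject:
  assumes "hangle (vertex Q (i + n - 1)) (vertex Q i) (vertex Q (Suc i))
    = hangle (vertex Q (j + n - 1)) (vertex Q j) (vertex Q (Suc j))"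
  shows "\<bar>\<tau> i\<bar> = \<bar>\<tau> j\<bar>"
proof -
  have cancel: "k * a - 1 = k * b - 1 \<Longrightarrow> k \<noteq> 0 \<Longrightarrow> a = b" for a b k :: real by simp
  have eq: "(\<tau> i)\<^sup>2 / (1 + (\<tau> i)\<^sup>2) = (\<tau> j)\<^sup>2 / (1 + (\<tau> j)\<^sup>2)"
    using assms unfolding interior_hangle_eq arccos_eq_iff[OF conjI[OF interior_hangle_cos_bounds interior_hangle_cos_bounds]]
    by (rule cancel) simp
  have "1 + (\<tau> i)\<^sup>2 > 0" "1 + (\<tau> j)\<^sup>2 > 0" by (simp_all add: add_pos_nonneg)
  then have "(\<tau> i)\<^sup>2 * (1 + (\<tau> j)\<^sup>2) = (\<tau> j)\<^sup>2 * (1 + (\<tau> i)\<^sup>2)" using eq by (simp add: frac_eq_eq)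
  then have "(\<tau> i)\<^sup>2 = (\<tau> j)\<^sup>2" by (simp add: algebra_simps)
  then show ?thesis by (simp add: power2_eq_iff abs_eq_iff)
qed

lemma \<tau>_mod: "\<tau> (i mod n) = \<tau> i"
proof -
  have "\<tau> (k + j * n) = \<tau> k" for k j
    by (induction j) (simp_all add: \<tau>_periodic flip: add.assoc add: add.commute[of n] add.left_commute)
  then show ?thesis by (metis mod_mult_div_eq mult.commute)
qed

lemma pi_n: "0 < pi / real n" "pi / real n < pi / 2" "0 < tan (pi / real n)"
proof -
  show 1: "0 < pi / real n" "pi / real n < pi / 2" using n3 by (auto simp: field_simps)
  show "0 < tan (pi / real n)" using 1 by (intro tan_gt_zero)
qed

lemma Peri_ge: "Peri Q \<ge> 2 * real n * artanh (sinh r * tan (pi / real n))"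
  and Peri_eq_imp: "Peri Q = 2 * real n * artanh (sinh r * tan (pi / real n)) \<Longrightarrow> \<bar>\<tau> i\<bar> = tan (pi / real n)"
proof -
  note * = sum_artanh_tan_ge[of "sinh r" n "\<lambda>i. arctan \<bar>\<tau> i\<bar>" "pi / real n"]
  have prem: "sinh r > 0" "\<And>i. 0 \<le> arctan \<bar>\<tau> i\<bar> \<and> arctan \<bar>\<tau> i\<bar> < pi / 2 \<and> sinh r * tan (arctan \<bar>\<tau> i\<bar>) < 1"
    "0 \<le> pi / real n" "pi / real n < pi / 2" "sinh r * tan (pi / real n) < 1"
    "real n * (pi / real n) \<le> (\<Sum>i<n. arctan \<bar>\<tau> i\<bar>)"
    using r_pos \<tau>_small pi_n arctan_ubound tan_pi_n_sinh_less_1 sum_abs_arctan_ge n_pos by (auto simp: tan_arctan)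
  show "Peri Q \<ge> 2 * real n * artanh (sinh r * tan (pi / real n))"
    using *(1)[OF prem] by (simp add: Peri_eq tan_arctan)
  assume "Peri Q = 2 * real n * artanh (sinh r * tan (pi / real n))"
  then have "arctan \<bar>\<tau> (i mod n)\<bar> = pi / real n"
    using *(2)[OF prem, of "i mod n"] n_pos by (simp add: Peri_eq tan_arctan)
  then have "\<bar>\<tau> (i mod n)\<bar> = tan (pi / real n)" by (metis tan_arctan)
  then show "\<bar>\<tau> i\<bar> = tan (pi / real n)" by (simp add: \<tau>_mod)
qed

end

section \<open>Polygons with equal central angles\<close>

text \<open>Both directions of the equality statement lead here: equality in Jensen's inequality and
  equal interior angles each make the central angles equal.\<close>

locale equiangular_polygon = centred_polygon +
  assumes abs_\<tau>_eq: "\<bar>\<tau> i\<bar> = \<bar>\<tau> j\<bar>"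
begin

lemma \<tau>_eq: "\<tau> i = \<tau> 0"
  using abs_\<tau>_eq[of i 0] same_sign[of i 0] by (auto simp: abs_if zero_le_mult_iff split: if_splits)

lemma q_rotate: "q i = q 0 * cis (real i * (2 * arctan (\<tau> 0)))"
proof -
  have "(\<Sum>j<i. arctan (\<tau> (Suc j))) = (\<Sum>j<i. arctan (\<tau> 0))"
    by (intro sum.cong refl arg_cong[where f = arctan] \<tau>_eq)
  then show ?thesis unfolding q_eq[of i] by (simp add: mult_ac)
qed

text \<open>With constant \<open>\<tau>\<close>, equal tangency points would give equal vertices. So
  the \<open>n\<close> points \<open>q i\<close> are distinct multiples of \<open>q 0\<close> by
  roots of unity, and counting shows that every root occurs, however often the polygon
  turns.\<close>

lemma q_image: "q ` {..<n} = (\<lambda>z. q 0 * z) ` {z. z ^ n = 1}"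
proof (rule card_subset_eq)
  show "finite ((\<lambda>z. q 0 * z) ` {z. z ^ n = 1})" using n_pos by (intro finite_imageI finite_roots_unity) simp
  show "q ` {..<n} \<subseteq> (\<lambda>z. q 0 * z) ` {z. z ^ n = 1}"
  proof
    fix x assume "x \<in> q ` {..<n}"
    then obtain i where x: "x = q 0 * cis (real i * (2 * arctan (\<tau> 0)))" by (metis imageE q_rotate)
    have "q 0 * cis (real n * (2 * arctan (\<tau> 0))) = q 0 * 1"
      using q_periodic[of 0] q_rotate[of n] by simp
    then have "cis (real n * (2 * arctan (\<tau> 0))) = 1" using q_nonzero[of 0] by (simp only: mult_left_cancel simp_thms)
    then have "cis (2 * arctan (\<tau> 0)) ^ n = 1" by (simp add: Complex.DeMoivre)
    then have "cis (real i * (2 * arctan (\<tau> 0))) ^ n = 1"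
      unfolding Complex.DeMoivre[symmetric] by (metis mult.commute power_mult power_one)
    then show "x \<in> (\<lambda>z. q 0 * z) ` {z. z ^ n = 1}" using x by blast
  qed
  have "inj_on q {..<n}"
  proof (rule inj_onI)
    fix i j assume ij: "i \<in> {..<n}" "j \<in> {..<n}" "q i = q j"
    then have "vertex Q i = vertex Q j" by (simp add: side_start \<tau>_eq[of i] \<tau>_eq[of j])
    then show "i = j" using ij by (simp add: vertex_eq_iff[OF polygon n_pos])
  qed
  then show "card (q ` {..<n}) = card ((\<lambda>z. q 0 * z) ` {z. z ^ n = 1})"
    using q_nonzero[of 0] n_pos by (simp add: card_image inj_on_def card_roots_unity_eq)
qed

lemma q_surj: "\<exists>j<n. q j = q 0 * cis (of_int m * (2 * pi / real n))"
proof -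
  have "cis (of_int m * (2 * pi / real n)) ^ n = cis (2 * pi * of_int m)"
    unfolding Complex.DeMoivre using n_pos by (simp add: mult.commute)
  also have "\<dots> = 1" by (simp add: complex_eq_iff)
  finally have "q 0 * cis (of_int m * (2 * pi / real n)) \<in> q ` {..<n}" unfolding q_image by blast
  then show ?thesis by auto
qed

lemma side_eq: "side Q i = (\<lambda>x. q i * Complex 1 x) ` {- \<bar>\<tau> 0\<bar>..\<bar>\<tau> 0\<bar>}"
  unfolding side_def side_end unfolding side_start closed_segment_mult_Complex_1 \<tau>_eq[of "Suc i"] \<tau>_eq[of i]
  by (simp add: closed_segment_eq_real_ivl abs_if)

text \<open>If the polygon wound around its centre more than once, the sides whose tangency points
  are \<open>2 * pi / n\<close> apart would cross.\<close>

lemma abs_\<tau>: "\<bar>\<tau> i\<bar> = tan (pi / real n)"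
proof -
  have "(\<Sum>i<n. arctan \<bar>\<tau> i\<bar>) = (\<Sum>i<n. arctan \<bar>\<tau> 0\<bar>)"
    by (intro sum.cong refl arg_cong[where f = arctan] abs_\<tau>_eq)
  then have "(\<Sum>i<n. arctan \<bar>\<tau> i\<bar>) = real n * arctan \<bar>\<tau> 0\<bar>" by simp
  then have "pi / real n \<le> arctan \<bar>\<tau> 0\<bar>" using sum_abs_arctan_ge n_pos by (simp add: field_simps)
  then have "tan (pi / real n) \<le> tan (arctan \<bar>\<tau> 0\<bar>)" using pi_n arctan_ubound by (intro tan_mono_le) auto
  then have le: "tan (pi / real n) \<le> \<bar>\<tau> 0\<bar>" by (simp add: tan_arctan)
  \<comment> \<open>\<open>m\<close> is the side whose tangency point comes next on the circle,
    which need not be the next side in the list. The point with coordinate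
    \<open>tan (pi / n)\<close> is where the two tangent lines meet.\<close>
  obtain m where m: "m < n" "q m = q 0 * cis (2 * pi / real n)" using q_surj[of 1] by auto
  have at: "arctan (tan (pi / real n)) = pi / real n" using pi_n by (intro arctan_tan) linarith+
  let ?t = "tan (pi / real n)"
  have X: "q 0 * Complex 1 ?t = q m * Complex 1 (- ?t)"
    unfolding m(2) Complex_1_polar[of ?t] Complex_1_polar[of "- ?t"] arctan_minus at
    by (simp add: mult.assoc cis_mult)
  have "m \<noteq> 0"
  proof
    assume "m = 0"
    then have "Complex 1 ?t = Complex 1 (- ?t)" using X q_nonzero[of 0] by simp
    then show False using pi_n by simp
  qed
  then have "0 mod n \<noteq> m mod n" using m by simp
  moreover have "q 0 * Complex 1 ?t \<in> side Q 0" unfolding side_eq using le pi_n by auto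
  moreover have "q 0 * Complex 1 ?t \<in> side Q m" unfolding X side_eq using le pi_n by auto
  ultimately have "q 0 * Complex 1 ?t \<in> {vertex Q 0, vertex Q (Suc 0)}"
    using side_Int_side[OF polygon n_pos, of 0 m] by blast
  then have "?t = \<tau> 0 \<or> ?t = - \<tau> 0"
    unfolding side_end unfolding side_start using q_nonzero[of 0] by (auto simp: \<tau>_eq[of "Suc 0"])
  then show ?thesis using abs_\<tau>_eq[of i 0] pi_n by auto
qed

lemma Peri_regular: "Peri Q = 2 * real n * artanh (sinh r * tan (pi / real n))"
  by (simp add: Peri_eq abs_\<tau>)

section \<open>The regular polygon as an intersection of half-planes\<close>

lemma norm_vertex_sq: "(norm (vertex Q i))\<^sup>2 = (tanh r)\<^sup>2 * (1 + (tan (pi / real n))\<^sup>2)"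
  using abs_\<tau>[of i] by (simp add: side_start norm_mult norm_q power_mult_distrib norm_Complex_1_sq) (metis power2_abs)

text \<open>Some tangency direction is within \<open>pi / n\<close> of the direction of
  \<open>y\<close>, found by rounding the argument. Its half-plane alone bounds the norm by that of
  a vertex.\<close>

lemma norm_le_vertex:
  assumes y: "\<And>j. j < n \<Longrightarrow> q j \<bullet> y \<le> (tanh r)\<^sup>2"
  shows "(norm y)\<^sup>2 \<le> (tanh r)\<^sup>2 * (1 + (tan (pi / real n))\<^sup>2)"
proof -
  define z where "z = y / q 0"
  have yz: "y = q 0 * z" using q_nonzero[of 0] by (simp add: z_def)
  define \<beta> where "\<beta> = Arg z"
  have z: "z = norm z * cis \<beta>" by (simp add: \<beta>_def rcis_cmod_Arg flip: rcis_def)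
  define m where "m = round (\<beta> * real n / (2 * pi))"
  obtain j where j: "j < n" "q j = q 0 * cis (of_int m * (2 * pi / real n))" using q_surj by blast
  let ?d = "of_int m * (2 * pi / real n) - \<beta>"
  have "\<bar>of_int m - \<beta> * real n / (2 * pi)\<bar> \<le> 1 / 2" unfolding m_def by (rule of_int_round_abs_le)
  then have "\<bar>of_int m - \<beta> * real n / (2 * pi)\<bar> * (2 * pi / real n) \<le> 1 / 2 * (2 * pi / real n)"
    by (intro mult_right_mono) auto
  also have "\<bar>of_int m - \<beta> * real n / (2 * pi)\<bar> * (2 * pi / real n)
      = \<bar>(of_int m - \<beta> * real n / (2 * pi)) * (2 * pi / real n)\<bar>" by (simp add: abs_mult)
  also have "(of_int m - \<beta> * real n / (2 * pi)) * (2 * pi / real n) = ?d"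
    using n_pos by (simp add: field_simps)
  finally have d: "\<bar>?d\<bar> \<le> pi / real n" by simp
  have "pi / real n \<le> pi" using pi_n by linarith
  then have "cos (pi / real n) \<le> cos \<bar>?d\<bar>" using d by (intro cos_monotone_0_pi_le) auto
  then have cd: "cos (pi / real n) \<le> cos ?d" by simp
  have "q j \<bullet> y = (tanh r)\<^sup>2 * (cis (of_int m * (2 * pi / real n)) \<bullet> z)"
    unfolding j(2) yz inner_mult_same norm_q ..
  also have "cis (of_int m * (2 * pi / real n)) \<bullet> z = norm z * cos ?d"
    by (subst z) (simp add: inner_complex_def cos_diff algebra_simps)
  finally have "(tanh r)\<^sup>2 * (norm z * cos ?d) \<le> (tanh r)\<^sup>2" using y[OF j(1)] by simp
  then have "norm z * cos ?d \<le> 1" using r_pos by simp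
  then have "norm z * cos (pi / real n) \<le> 1" using mult_left_mono[OF cd norm_ge_zero[of z]] by linarith
  moreover have c: "cos (pi / real n) > 0" using pi_n by (intro cos_gt_zero)
  ultimately have "(norm z * cos (pi / real n))\<^sup>2 \<le> 1\<^sup>2" by (intro power_mono) auto
  then have "(norm z)\<^sup>2 \<le> inverse ((cos (pi / real n))\<^sup>2)" using c by (simp add: power_mult_distrib field_simps)
  also have "\<dots> = 1 + (tan (pi / real n))\<^sup>2" using c tan_sec[of "pi / real n"] by (simp add: power_inverse)
  finally show ?thesis unfolding yz by (simp add: norm_mult norm_q power_mult_distrib mult_left_mono)
qed

text \<open>On the tangent line at \<open>q i\<close> the norm grows with the coordinate, so the
  norm bound cuts the line down to the side.\<close>

lemma in_side:
  assumes y: "\<And>j. j < n \<Longrightarrow> q j \<bullet> y \<le> (tanh r)\<^sup>2" and i: "q i \<bullet> y = (tanh r)\<^sup>2"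
  shows "y \<in> side Q i"
proof -
  define x where "x = Im (y / q i)"
  have "Re (y / q i) = (q i \<bullet> y) / (norm (q i))\<^sup>2" by (simp add: Re_divide inner_complex_def cmod_power2 mult.commute)
  then have "Re (y / q i) = 1" using r_pos by (simp add: i norm_q)
  then have "y / q i = Complex 1 x" by (simp add: complex_eq_iff x_def)
  then have yx: "y = q i * Complex 1 x" using q_nonzero[of i] by (simp add: field_simps)
  have "(norm y)\<^sup>2 \<le> (tanh r)\<^sup>2 * (1 + (tan (pi / real n))\<^sup>2)" by (rule norm_le_vertex[OF y])
  then have "x\<^sup>2 \<le> (tan (pi / real n))\<^sup>2" using r_pos
    by (simp add: yx norm_mult norm_q power_mult_distrib norm_Complex_1_sq)
  then have "\<bar>x\<bar> \<le> \<bar>\<tau> 0\<bar>" unfolding abs_le_square_iff abs_\<tau>[symmetric, of 0] power2_abs .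
  then show ?thesis unfolding side_eq yx by (intro imageI) auto
qed

lemma inner_vertex_le: "q j \<bullet> vertex Q i \<le> (tanh r)\<^sup>2"
proof -
  define \<theta> where "\<theta> = arctan (\<tau> 0)"
  have at: "arctan (tan (pi / real n)) = pi / real n" using pi_n by (intro arctan_tan) linarith+
  have \<theta>: "\<theta> = pi / real n \<or> \<theta> = - (pi / real n)"
    using abs_\<tau>[of 0] at unfolding \<theta>_def by (metis abs_if arctan_minus minus_minus)
  have c: "cos \<theta> > 0" using \<theta> pi_n by (intro cos_gt_zero_pi) (elim disjE; linarith)+
  have C: "Complex 1 (- \<tau> 0) = of_real (1 / cos \<theta>) * cis (- \<theta>)"
  proof -
    have "\<tau> 0 = tan \<theta>" by (simp add: \<theta>_def tan_arctan)
    then have "\<tau> 0 = sin \<theta> / cos \<theta>" by (simp add: tan_def)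
    then show ?thesis using c by (simp add: complex_eq_iff)
  qed
  \<comment> \<open>The vertex is at angle \<open>(2 * i - 1) * \<theta>\<close> and
    \<open>q j\<close> at \<open>2 * j * \<theta>\<close>, both measured from \<open>q 0\<close>;
    the difference is an odd multiple of \<open>\<theta>\<close>.\<close>
  define m where "m = int i - int j - 1"
  have "q j \<bullet> vertex Q i = (q 0 * cis (real j * (2 * \<theta>))) \<bullet> (q 0 * (cis (real i * (2 * \<theta>)) * Complex 1 (- \<tau> 0)))"
    unfolding side_start \<tau>_eq[of i] by (simp add: q_rotate[of i] q_rotate[of j] \<theta>_def mult.assoc)
  also have "\<dots> = (tanh r)\<^sup>2 * (cis (real j * (2 * \<theta>)) \<bullet> (1 / cos \<theta>) *\<^sub>R cis (real i * (2 * \<theta>) - \<theta>))"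
  proof -
    have gen: "cis a * (of_real k * cis b) = k *\<^sub>R cis (a + b)" for a b k :: real
      by (simp add: scaleR_conv_of_real cis_mult[symmetric] mult_ac)
    show ?thesis unfolding inner_mult_same norm_q C gen by (simp only: diff_conv_add_uminus)
  qed
  also have "cis (real j * (2 * \<theta>)) \<bullet> (1 / cos \<theta>) *\<^sub>R cis (real i * (2 * \<theta>) - \<theta>)
      = cos ((real i * (2 * \<theta>) - \<theta>) - real j * (2 * \<theta>)) / cos \<theta>"
    by (simp add: inner_complex_def cos_diff[of "_ - \<theta>"] add_divide_distrib mult.commute)
  also have "(real i * (2 * \<theta>) - \<theta>) - real j * (2 * \<theta>) = of_int (2 * m + 1) * \<theta>"
    by (simp add: m_def algebra_simps)
  also have "cos (of_int (2 * m + 1) * \<theta>) = cos (of_int (2 * m + 1) * (pi / real n))"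
    using \<theta> cos_minus[of "of_int (2 * m + 1) * (pi / real n)"] by (elim disjE) (simp_all only: mult_minus_right)
  finally have eq: "q j \<bullet> vertex Q i = (tanh r)\<^sup>2 * (cos (of_int (2 * m + 1) * (pi / real n)) / cos \<theta>)" .
  have "cos \<theta> = cos (pi / real n)" using \<theta> by auto
  then have "cos (of_int (2 * m + 1) * (pi / real n)) / cos \<theta> \<le> 1"
    using cos_odd_pi_div_le[OF n_pos, of m] c by (simp del: of_int_add of_int_mult)
  then show ?thesis unfolding eq by (intro mult_left_le) simp_all
qed

lemma inner_side: "y \<in> side Q j \<Longrightarrow> q j \<bullet> y = (tanh r)\<^sup>2"
proof -
  assume "y \<in> side Q j"
  then obtain x where "y = q j * Complex 1 x" unfolding side_eq by auto
  then show ?thesis using inner_mult_same[of "q j" 1 "Complex 1 x"] by (simp add: norm_q inner_complex_def)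
qed

text \<open>All vertices have the same norm, and on a side this norm is attained only at the ends.
  Hence three distinct vertices never lie on one tangent line.\<close>

lemma inner_vertex_eq:
  assumes eq: "q j \<bullet> vertex Q i = (tanh r)\<^sup>2"
  shows "vertex Q i = vertex Q j \<or> vertex Q i = vertex Q (Suc j)"
proof -
  have "vertex Q i \<in> side Q j" by (rule in_side[OF inner_vertex_le eq])
  then obtain x where x: "vertex Q i = q j * Complex 1 x" unfolding side_eq by auto
  have "(norm (vertex Q i))\<^sup>2 = (norm (vertex Q j))\<^sup>2" unfolding norm_vertex_sq ..
  then have "x\<^sup>2 = (\<tau> 0)\<^sup>2" unfolding x side_start[of j] using r_pos
    by (simp add: norm_mult norm_q power_mult_distrib norm_Complex_1_sq \<tau>_eq[of j])
  then have "x = \<tau> 0 \<or> x = - \<tau> 0" by (simp add: power2_eq_iff)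
  then show ?thesis unfolding side_end x side_start[of j] \<tau>_eq[of j] \<tau>_eq[of "Suc j"] by auto
qed

end

section \<open>Moving the incentre to the origin\<close>

lemma hyperbolic_polygon_map_htrans:
  assumes c: "c \<in> ball 0 1" and P: "hyperbolic_polygon n P" and n: "n > 0"
  shows "vertex (map (htrans c) P) i = htrans c (vertex P i)"
    and "side (map (htrans c) P) i = htrans c ` side P i"
    and "hyperbolic_polygon n (map (htrans c) P)"
proof -
  let ?F = "htrans c"
  let ?Q = "map ?F P"
  have len: "length P = n" and P1: "set P \<subseteq> ball 0 1" "distinct P" using P by (auto simp: hyperbolic_polygon_def)
  have inj: "inj_on ?F (ball 0 1)" by (rule inj_on_inverseI[of _ "htrans (- c)"]) (rule htrans_inverse[OF c])
  have v: "vertex ?Q i = ?F (vertex P i)" for i using n len by (simp add: vertex_def)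
  then show "vertex ?Q i = ?F (vertex P i)" .
  note vb = vertex_in_ball[OF P n]
  have s: "side ?Q i = ?F ` side P i" for i
    unfolding side_def v by (rule htrans_closed_segment[OF c vb vb, symmetric])
  then show "side ?Q i = ?F ` side P i" .
  have sb: "side P i \<subseteq> ball 0 1" for i unfolding side_def by (rule closed_segment_in_ball[OF vb vb])
  have "side ?Q i \<inter> side ?Q j = {vertex ?Q i, vertex ?Q (Suc i)} \<inter> {vertex ?Q j, vertex ?Q (Suc j)}"
    if "i < n" "j < n" "i \<noteq> j" for i j
  proof -
    have "side ?Q i \<inter> side ?Q j = ?F ` (side P i \<inter> side P j)"
      unfolding s by (rule inj_on_image_Int[OF inj sb sb, symmetric])
    also have "side P i \<inter> side P j = {vertex P i, vertex P (Suc i)} \<inter> {vertex P j, vertex P (Suc j)}"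
      using P that by (simp add: hyperbolic_polygon_def)
    also have "?F ` \<dots> = ?F ` {vertex P i, vertex P (Suc i)} \<inter> ?F ` {vertex P j, vertex P (Suc j)}"
      using vb by (intro inj_on_image_Int[OF inj]) auto
    finally show ?thesis unfolding v by simp
  qed
  moreover have "distinct ?Q" using inj_on_subset[OF inj P1(1)] P1(2) by (simp add: distinct_map)
  moreover have "set ?Q \<subseteq> ball 0 1" using P1(1) htrans_in_ball[OF c] by auto
  ultimately show "hyperbolic_polygon n ?Q" using len by (simp add: hyperbolic_polygon_def)
qed

lemma incircle_map_htrans:
  assumes P: "hyperbolic_polygon n P" and n: "n > 0" and inc: "incircle P c r"
  shows "incircle (map (htrans c) P) 0 r"
proof -
  have c: "c \<in> ball 0 1" using inc by (simp add: incircle_def)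
  show ?thesis using inc segment_tangent_htrans[OF c vertex_in_ball[OF P n] vertex_in_ball[OF P n]]
    unfolding incircle_def hyperbolic_polygon_map_htrans(1)[OF c P n] by auto
qed

text \<open>Clearing the denominator of the projective map turns a half-plane in the image into a
  half-plane in the source.\<close>

lemma htrans_half_plane:
  assumes c: "c \<in> ball 0 1" and x: "x \<in> ball 0 1" and y: "y \<in> ball 0 1" and t: "0 \<le> t" "t \<le> 1"
  shows "(q \<bullet> htrans c ((1 - t) *\<^sub>R x + t *\<^sub>R y) - k) * (1 - c \<bullet> ((1 - t) *\<^sub>R x + t *\<^sub>R y))
    = (1 - t) * ((q \<bullet> htrans c x - k) * (1 - c \<bullet> x)) + t * ((q \<bullet> htrans c y - k) * (1 - c \<bullet> y))"
proof -
  define s where "s = sqrt (1 - (norm c)\<^sup>2)"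
  define N where "N = (\<lambda>x. s *\<^sub>R x + ((c \<bullet> x) / (1 + s)) *\<^sub>R c - c)"
  have l: "(q \<bullet> htrans c v - k) * (1 - c \<bullet> v) = q \<bullet> N v - k * (1 - c \<bullet> v)" if "v \<in> ball 0 1" for v
    using inner_less_1[OF c that] by (simp add: htrans_def N_def s_def left_diff_distrib)
  have z: "(1 - t) *\<^sub>R x + t *\<^sub>R y \<in> ball 0 1"
    using closed_segment_in_ball[OF x y] t by (force simp: closed_segment_def)
  then show ?thesis unfolding l[OF x] l[OF y] l[OF z]
    by (simp add: N_def inner_add_right inner_diff_right add_divide_distrib diff_divide_distrib algebra_simps)
qed

lemma continuous_on_htrans:
  assumes c: "c \<in> ball 0 1"
  shows "continuous_on (ball 0 1) (htrans c)"
proof -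
  have "1 + sqrt (1 - (norm c)\<^sup>2) \<noteq> 0"
    using norm_sq_less_1[OF c] real_sqrt_ge_zero[of "1 - (norm c)\<^sup>2"] by linarith
  moreover have "1 - c \<bullet> x \<noteq> 0" if "x \<in> ball 0 1" for x using inner_less_1[OF c that] by simp
  ultimately show ?thesis unfolding htrans_def by (intro continuous_intros) auto
qed

text \<open>The direction tested by \<open>convex_at\<close> is a Euclidean sum, which a projective
  map does not preserve, so convexity is shown at \<open>P\<close> and not at \<open>Q\<close>. The
  half-planes of \<open>Q\<close> are pulled back to an open set \<open>U\<close>, and the test
  points near the vertex lie in it.\<close>

lemma (in equiangular_polygon) convex_at_of_htrans:
  assumes c: "c \<in> ball 0 1" and P: "hyperbolic_polygon n P" and Q: "Q = map (htrans c) P"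
  shows "convex_at P i"
proof -
  note map = hyperbolic_polygon_map_htrans[OF c P n_pos, folded Q]
  note vb = vertex_in_ball[OF P n_pos]
  have len: "length P = n" using P by (simp add: hyperbolic_polygon_def)
  have c': "- c \<in> ball 0 1" using c by simp
  define \<rho> where "\<rho> = (tanh r)\<^sup>2"
  define F where "F = htrans c"
  define G where "G = htrans (- c)"
  have FG: "F (G y) = y" "G y \<in> ball 0 1" if "y \<in> ball 0 1" for y
    using htrans_inverse'[OF c that] htrans_in_ball[OF c' that] by (auto simp: F_def G_def)
  have GF: "G (F x) = x" "F x \<in> ball 0 1" if "x \<in> ball 0 1" for x
    using htrans_inverse[OF c that] htrans_in_ball[OF c that] by (auto simp: F_def G_def)
  define K where "K = {y. \<forall>j\<in>{..<n}. q j \<bullet> y \<le> \<rho>}"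
  define U where "U = {x \<in> ball 0 1. \<forall>j\<in>{..<n}. q j \<bullet> F x < \<rho>}"
  \<comment> \<open>\<open>K\<close> lies in a closed disc of radius below 1, so its preimage is
    compact in the open disc. Frontier points of \<open>U\<close> therefore stay where the map is
    invertible.\<close>
  have Kball: "K \<subseteq> cball 0 (norm (vertex Q 0))"
  proof
    fix y assume "y \<in> K"
    then have "(norm y)\<^sup>2 \<le> (norm (vertex Q 0))\<^sup>2"
      unfolding norm_vertex_sq by (intro norm_le_vertex) (simp add: K_def \<rho>_def)
    then show "y \<in> cball 0 (norm (vertex Q 0))" by (simp add: power2_le_iff_abs_le)
  qed
  then have Kb: "K \<subseteq> ball 0 1" using vertex_in_ball[OF polygon n_pos, of 0] by auto
  have "K = (\<Inter>j\<in>{..<n}. {y. q j \<bullet> y \<le> \<rho>})" by (auto simp: K_def)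
  then have "closed K" by (simp add: closed_INT closed_halfspace_le)
  moreover have "bounded K" using Kball bounded_cball bounded_subset by blast
  ultimately have "compact K" by (simp add: compact_eq_bounded_closed)
  then have "compact (G ` K)"
    using continuous_on_subset[OF continuous_on_htrans[OF c'] Kb] unfolding G_def by (rule compact_continuous_image[rotated])
  moreover have "U \<subseteq> G ` K"
  proof
    fix x assume "x \<in> U"
    then have "F x \<in> K" "G (F x) = x" using GF by (auto simp: U_def K_def intro: less_imp_le)
    then show "x \<in> G ` K" by (metis imageI)
  qed
  ultimately have clU: "closure U \<subseteq> G ` K" by (simp add: closure_minimal compact_imp_closed)
  have "open {x \<in> ball 0 1. q j \<bullet> F x < \<rho>}" for j
  proof -
    have "continuous_on (ball 0 1) (\<lambda>x. q j \<bullet> F x)"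
      unfolding F_def by (intro continuous_intros continuous_on_htrans c)
    then have "open (ball 0 1 \<inter> (\<lambda>x. q j \<bullet> F x) -` {..<\<rho>})"
      by (rule continuous_open_preimage) auto
    then show ?thesis by (simp add: vimage_def Int_def)
  qed
  moreover have "U = (\<Inter>j\<in>{..<n}. {x \<in> ball 0 1. q j \<bullet> F x < \<rho>})" using n_pos by (auto simp: U_def)
  ultimately have oU: "open U" by (simp add: open_INT)
  have frU: "frontier U \<subseteq> boundary P"
  proof
    fix x assume "x \<in> frontier U"
    then have x: "x \<in> closure U" "x \<notin> U" using oU by (auto simp: frontier_def interior_open)
    then obtain y where y: "y \<in> K" "x = G y" using clU by blast
    have yb: "y \<in> ball 0 1" using y Kb by blast
    have xb: "x \<in> ball 0 1" and Fx: "F x = y" using FG[OF yb] y by auto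
    then obtain j where j: "j < n" "\<not> q j \<bullet> y < \<rho>" using x(2) by (auto simp: U_def)
    then have "q j \<bullet> y = \<rho>" using y(1) by (force simp: K_def)
    then have "y \<in> side Q j" using y(1) by (intro in_side) (auto simp: K_def \<rho>_def)
    then have "y \<in> F ` side P j" unfolding map(2) F_def .
    then obtain z where z: "z \<in> side P j" "y = F z" by blast
    have "z \<in> ball 0 1" using z(1) closed_segment_in_ball[OF vb vb] unfolding side_def by blast
    then have "x = z" using y(2) z(2) GF by simp
    then show "x \<in> boundary P" using z(1) j(1) len by (auto simp: boundary_def)
  qed
  have U_bdry: "U \<inter> boundary P = {}"
  proof -
    have "x \<notin> U" if "j < n" "x \<in> side P j" for x j
    proof -
      have "F x \<in> side Q j" using that unfolding map(2) F_def by blast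
      then have "\<not> q j \<bullet> F x < \<rho>" using inner_side[of "F x" j] by (simp add: \<rho>_def)
      then show ?thesis using that(1) by (auto simp: U_def)
    qed
    then show ?thesis by (auto simp: boundary_def len)
  qed
  have U_inside: "U \<subseteq> inside (boundary P)"
  proof
    fix x assume x: "x \<in> U"
    \<comment> \<open>To leave \<open>U\<close>, the component would have to cross the frontier of
      \<open>U\<close>, which lies in the boundary of the polygon. So it stays in the bounded set
      \<open>U\<close>.\<close>
    let ?C = "connected_component_set (- boundary P) x"
    have xC: "x \<in> ?C" using x U_bdry by auto
    have "?C \<inter> frontier U = {}" using connected_component_subset[of "- boundary P" x] frU by blast
    then have "?C - U = {}"
      using connected_Int_frontier[OF connected_connected_component, of "- boundary P" x U] x xC by blast
    then have "?C \<subseteq> ball 0 1" by (auto simp: U_def)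
    then have "bounded ?C" using bounded_ball bounded_subset by blast
    then show "x \<in> inside (boundary P)" using x U_bdry by (auto simp: inside_def)
  qed
  define v where "v = vertex P i"
  define a where "a = vertex P (i + n - 1)"
  define b where "b = vertex P (Suc i)"
  have dist: "v \<noteq> a" "v \<noteq> b" "a \<noteq> b"
  proof -
    define k where "k = i + n - 1"
    have "i mod n = Suc k mod n" "Suc i mod n = Suc (Suc k) mod n" using n_pos by (auto simp: k_def mod_Suc)
    then show "v \<noteq> a" "v \<noteq> b" "a \<noteq> b"
      unfolding v_def a_def b_def vertex_eq_iff[OF P n_pos] k_def[symmetric]
      using Suc_mod_neq[OF n3, of k] Suc_mod_neq[OF n3, of i] by auto
  qed
  have "v + t *\<^sub>R ((a - v) + (b - v)) \<in> U" if t: "0 < t" "t < 1 / 2" for t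
  proof -
    \<comment> \<open>The test point has weights \<open>1 - 2 * t\<close>, \<open>t\<close>,
      \<open>t\<close> at \<open>v\<close>, \<open>a\<close>, \<open>b\<close>, hence the bound
      \<open>1 / 2\<close> on \<open>t\<close>. Passing through the midpoint \<open>m\<close> lets
      the half-plane identity for two points be applied twice.\<close>
    define m where "m = (1 - 1 / 2) *\<^sub>R a + (1 / 2) *\<^sub>R b"
    define z where "z = (1 - 2 * t) *\<^sub>R v + (2 * t) *\<^sub>R m"
    have zt: "v + t *\<^sub>R ((a - v) + (b - v)) = z" by (simp add: z_def m_def complex_eq_iff algebra_simps)
    have ball: "v \<in> ball 0 1" "a \<in> ball 0 1" "b \<in> ball 0 1" using vb by (auto simp: v_def a_def b_def)
    have mb: "m \<in> ball 0 1" unfolding m_def by (rule convexD_alt[OF convex_ball ball(2,3)]) auto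
    have zb: "z \<in> ball 0 1" unfolding z_def by (rule convexD_alt[OF convex_ball ball(1) mb]) (use t in auto)
    have "q j \<bullet> F z < \<rho>" for j
    proof -
      define l where "l = (\<lambda>x. (q j \<bullet> F x - \<rho>) * (1 - c \<bullet> x))"
      have pos: "1 - c \<bullet> x > 0" if "x \<in> ball 0 1" for x using inner_less_1[OF c that] by simp
      have le: "l (vertex P k) \<le> 0" for k
        using inner_vertex_le[of j k] pos[OF vb[of k]]
        by (simp add: l_def \<rho>_def F_def map(1) mult_le_0_iff)
      have eq: "vertex P k = vertex P j \<or> vertex P k = vertex P (Suc j)" if "l (vertex P k) = 0" for k
      proof -
        have "q j \<bullet> vertex Q k = (tanh r)\<^sup>2" using that pos[OF vb[of k]] by (simp add: l_def \<rho>_def F_def map(1))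
        from inner_vertex_eq[OF this] show ?thesis
          unfolding vertex_eq_iff[OF polygon n_pos] vertex_eq_iff[OF P n_pos] .
      qed
      have "l z = (1 - 2 * t) * l v + (2 * t) * l m"
        unfolding l_def z_def F_def by (rule htrans_half_plane[OF c ball(1) mb]) (use t in auto)
      moreover have "l m = (1 - 1 / 2) * l a + (1 / 2) * l b"
        unfolding l_def m_def F_def by (rule htrans_half_plane[OF c ball(2,3)]) auto
      ultimately have lz: "l z = (1 - 2 * t) * l v + t * l a + t * l b" by (simp add: algebra_simps)
      have neg: "l v \<le> 0" "l a \<le> 0" "l b \<le> 0" unfolding v_def a_def b_def by (rule le)+
      then have le0: "(1 - 2 * t) * l v \<le> 0" "t * l a \<le> 0" "t * l b \<le> 0"
        using t by (auto intro: mult_nonneg_nonpos)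
      \<comment> \<open>Three distinct vertices cannot all be ends of the side \<open>j\<close>, so
        at least one of the three weighted terms is strictly negative.\<close>
      have "l v \<noteq> 0 \<or> l a \<noteq> 0 \<or> l b \<noteq> 0"
      proof (rule ccontr)
        assume "\<not> ?thesis"
        then have "v = vertex P j \<or> v = vertex P (Suc j)" "a = vertex P j \<or> a = vertex P (Suc j)"
          "b = vertex P j \<or> b = vertex P (Suc j)"
          unfolding v_def a_def b_def by (auto intro!: eq)
        then show False using dist by (elim disjE) simp_all
      qed
      then consider "l v < 0" | "l a < 0" | "l b < 0" using neg by fastforce
      then have "l z < 0"
      proof cases
        case 1
        then have "(1 - 2 * t) * l v < 0" using t by (intro mult_pos_neg) auto
        then show ?thesis using le0 lz by linarith
      next
        case 2
        then have "t * l a < 0" using t by (intro mult_pos_neg)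
        then show ?thesis using le0 lz by linarith
      next
        case 3
        then have "t * l b < 0" using t by (intro mult_pos_neg)
        then show ?thesis using le0 lz by linarith
      qed
      then show ?thesis using pos[OF zb] by (simp add: l_def mult_less_0_iff)
    qed
    then show ?thesis unfolding zt using zb by (simp add: U_def)
  qed
  then have "\<forall>\<^sub>F t in at_right 0. v + t *\<^sub>R ((a - v) + (b - v)) \<in> inside (boundary P)"
    using U_inside unfolding eventually_at_right_field by (intro exI[of _ "1 / 2"]) auto
  then show ?thesis by (simp add: convex_at_def Let_def v_def a_def b_def len)
qed

theorem theorem1p1:
  fixes n :: nat and P :: "complex list" and c :: complex and r :: real
  assumes "n \<ge> 3"
    and "hyperbolic_polygon n P"
    and "incircle P c r"
  shows "Peri P \<ge> 2 * real n * artanh (tan (pi / real n) * sinh r) \<and>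
    (Peri P = 2 * real n * artanh (tan (pi / real n) * sinh r) \<longleftrightarrow> regular P)"
proof -
  have n: "n > 0" using assms(1) by simp
  have c: "c \<in> ball 0 1" using assms(3) by (simp add: incircle_def)
  have len: "length P = n" using assms(2) by (simp add: hyperbolic_polygon_def)
  define Q where "Q = map (htrans c) P"
  note map = hyperbolic_polygon_map_htrans[OF c assms(2) n, folded Q_def]
  note vb = vertex_in_ball[OF assms(2) n]
  obtain q \<tau> where "centred_polygon n Q r q \<tau>"
    using centred_polygon_exists[OF assms(1) map(3)] incircle_map_htrans[OF assms(2) n assms(3)]
    unfolding Q_def by blast
  then interpret centred_polygon n Q r q \<tau> .
  have sl: "side_length P i = side_length Q i" for i
    unfolding side_length_def map(1) by (rule hdist_htrans[OF c vb vb, symmetric])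
  then have Peri: "Peri P = Peri Q" by (simp add: Peri_def len length_Q)
  define ang where "ang = (\<lambda>i. hangle (vertex Q (i + n - 1)) (vertex Q i) (vertex Q (Suc i)))"
  have ang: "hangle (vertex P (i + n - 1)) (vertex P i) (vertex P (Suc i)) = ang i" for i
    unfolding ang_def map(1) by (rule hangle_htrans[OF c vb vb vb, symmetric])
  have ia: "interior_angle P i = (if convex_at P i then ang i else 2 * pi - ang i)" for i
    by (simp add: interior_angle_def Let_def len ang del: One_nat_def)
  have "Peri P = 2 * real n * artanh (sinh r * tan (pi / real n)) \<longleftrightarrow> regular P"
  proof
    assume eq: "Peri P = 2 * real n * artanh (sinh r * tan (pi / real n))"
    have \<tau>: "\<bar>\<tau> i\<bar> = tan (pi / real n)" for i using Peri_eq_imp eq Peri by simp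
    interpret equiangular_polygon n Q r q \<tau> by unfold_locales (simp add: \<tau>)
    have convex: "convex_at P i" for i by (rule convex_at_of_htrans[OF c assms(2) Q_def])
    have ang_eq: "ang i = ang j" for i j
      unfolding ang_def interior_hangle_eq using \<tau>_eq[of i] \<tau>_eq[of j] by simp
    have "interior_angle P i = interior_angle P j" for i j
      unfolding ia using convex ang_eq[of i j] by simp
    moreover have "side_length P i = side_length P j" for i j
      unfolding sl side_length_eq \<tau> ..
    ultimately show "regular P" unfolding regular_def by blast
  next
    assume reg: "regular P"
    have ang_pi: "ang i \<le> pi" for i unfolding ang_def by (rule interior_hangle_le_pi)
    have "\<bar>\<tau> i\<bar> = \<bar>\<tau> j\<bar>" if "i < n" "j < n" for i j
    proof -
      have "interior_angle P i = interior_angle P j" using reg that len unfolding regular_def by blast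
      \<comment> \<open>If one vertex takes the branch \<open>ang\<close> and the other
        \<open>2 * pi - ang\<close>, then \<open>ang \<le> pi\<close> makes both equal to
        \<open>pi\<close>. So equality passes to \<open>ang\<close> in every case.\<close>
      then have "ang i = ang j" using ang_pi[of i] ang_pi[of j] unfolding ia by (auto split: if_splits)
      then show ?thesis unfolding ang_def by (rule interior_hangle_inject)
    qed
    then have "\<bar>\<tau> i\<bar> = \<bar>\<tau> j\<bar>" for i j using mod_less_divisor[OF n] \<tau>_mod by metis
    then interpret equiangular_polygon n Q r q \<tau> by unfold_locales
    show "Peri P = 2 * real n * artanh (sinh r * tan (pi / real n))" using Peri Peri_regular by simp
  qed
  then show ?thesis using Peri_ge Peri by (simp add: mult.commute[of "tan (pi / real n)"])
qed

end
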